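(* Let $F:\mathbb{R}^{m\times n}\to\mathbb{R}^{m\times n}$ satisfy $\|F(X)\|_F\le B$ for all $X\in\mathbb{R}^{m\times n}$, with a constant $B>0$. Let $Y_0\in\mathcal{M}_r$ and set $$t_1:=\frac{\sigma_r(Y_0)}{2\,C_{m,r}\,C_{n,r}\,B},$$ where $\sigma_r(Y_0)$ is the smallest nonzero singular value of $Y_0$. Then there exist $t_{\max}>t_1$ and a solution $Y:[0,t_{\max})\to\mathcal{M}_r$ of the differential inclusion (DLRA-DEIM) $$Y(0)=Y_0,\qquad \dot Y(t)\in\mathcal{F}(Y(t))\ \text{ for almost every } t\in[0,t_{\max}).$$
   Context: $\mathcal{M}_r=\{X\in\mathbb{R}^{m\times n}\mid\mathrm{rank}(X)=r\}$; $\|\cdot\|_F$ is the Frobenius norm. A selection matrix is a matrix whose columns are distinct standard unit vectors. A DEIM procedure is a rule assigning to each $U\in\mathbb{R}^{m\times r}$ with orthonormal columns a selection matrix $S_U\in\mathbb{R}^{m\times r}$ with $S_U^\top U$ invertible and $\|(S_U^\top U)^{-1}\|_2\le C_{m,r}$, and to each $V\in\mathbb{R}^{n\times r}$ with orthonormal columns a selection matrix $S_V\in\mathbb{R}^{n\times r}$ with $S_V^\top V$ invertible and $\|(S_V^\top V)^{-1}\|_2\le C_{n,r}$, where $C_{m,r},C_{n,r}$ are constants. For $Y=U\Sigma V^\top\in\mathcal{M}_r$ ($U,V$ with orthonormal columns) define $$\mathcal{P}^{\angle}_Y[Z]=P_U^{\angle}Z-P_U^{\angle}ZP_V^{\vee}+ZP_V^{\vee},\qquad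 P_U^{\angle}=U(S_U^\top U)^{-1}S_U^\top,\quad P_V^{\vee}=S_V(V^\top S_V)^{-1}V^\top.$$ It is assumed that $f(Y)=\mathcal{P}^{\angle}_Y[F(Y)]$ is well defined as a function of $Y\in\mathcal{M}_r$. With $\mathcal{B}=\{X\in\mathbb{R}^{m\times n}:\|X\|_F\le1\}$ set $$\mathcal{F}(Y)=\bigcap_{\epsilon>0}\overline{\mathrm{conv}}\big[f\big((Y+\epsilon\mathcal{B})\cap\mathcal{M}_r\big)\big],\quad Y\in\mathcal{M}_r,$$ where $\overline{\mathrm{conv}}$ denotes the closed convex hull. A solution on $[0,t_{\max})$ is a function $Y:[0,t_{\max})\to\mathcal{M}_r$ that is absolutely continuous on every $[0,T]$ with $T<t_{\max}$ and satisfies the initial condition and the inclusion for almost every $t$. *)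

theory Defs
  imports "HOL-Analysis.Analysis"
begin

text \<open>
  An \<open>m \<times> n\<close> matrix has type \<^typ>\<open>real ^ 'n ^ 'm\<close>; the library \<^const>\<open>norm\<close> on this type
  is the Frobenius norm. The rank \<open>r\<close> is \<open>CARD('r)\<close>, hence positive.
\<close>

definition fixed_rank :: "nat \<Rightarrow> (real ^ 'n ^ 'm) set"
  where "fixed_rank r = {X. rank X = r}"

definition spectral_norm :: "real ^ 'n ^ 'm \<Rightarrow> real"
  where "spectral_norm A = onorm (\<lambda>x. A *v x)"

definition singular_value :: "real ^ 'n ^ 'm \<Rightarrow> real \<Rightarrow> bool"
  where "singular_value A \<sigma> \<longleftrightarrow>
    \<sigma> \<ge> 0 \<and> (\<exists>v. v \<noteq> 0 \<and> (transpose A ** A) *v v = \<sigma>\<^sup>2 *\<^sub>R v)"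

definition smallest_nonzero_singular_value :: "real ^ 'n ^ 'm \<Rightarrow> real"
  where "smallest_nonzero_singular_value A = Min {\<sigma>. singular_value A \<sigma> \<and> \<sigma> \<noteq> 0}"

definition orthonormal_columns :: "real ^ 'r ^ 'm \<Rightarrow> bool"
  where "orthonormal_columns U \<longleftrightarrow> transpose U ** U = mat 1"

definition selection_matrix :: "real ^ 'r ^ 'm \<Rightarrow> bool"
  where "selection_matrix S \<longleftrightarrow> (\<exists>p. inj p \<and> (\<forall>j. column j S = axis (p j) 1))"

text \<open>
  A rule is a total function on matrices, constrained only on arguments with orthonormal columns.
\<close>

definition deim_rule :: "(real ^ 'r ^ 'm \<Rightarrow> real ^ 'r ^ 'm) \<Rightarrow> real \<Rightarrow> bool"
  where "deim_rule S C \<longleftrightarrow>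
    (\<forall>U. orthonormal_columns U \<longrightarrow>
       selection_matrix (S U) \<and>
       invertible (transpose (S U) ** U) \<and>
       spectral_norm (matrix_inv (transpose (S U) ** U)) \<le> C)"

definition oblique_left :: "(real ^ 'r ^ 'm \<Rightarrow> real ^ 'r ^ 'm) \<Rightarrow> real ^ 'r ^ 'm \<Rightarrow> real ^ 'm ^ 'm"
  where "oblique_left S U = U ** matrix_inv (transpose (S U) ** U) ** transpose (S U)"

definition oblique_right :: "(real ^ 'r ^ 'n \<Rightarrow> real ^ 'r ^ 'n) \<Rightarrow> real ^ 'r ^ 'n \<Rightarrow> real ^ 'n ^ 'n"
  where "oblique_right S V = S V ** matrix_inv (transpose V ** S V) ** transpose V"

definition oblique_tangent_projection ::
    "(real ^ 'r ^ 'm \<Rightarrow> real ^ 'r ^ 'm) \<Rightarrow> (real ^ 'r ^ 'n \<Rightarrow> real ^ 'r ^ 'n) \<Rightarrow>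
     real ^ 'r ^ 'm \<Rightarrow> real ^ 'r ^ 'n \<Rightarrow> real ^ 'n ^ 'm \<Rightarrow> real ^ 'n ^ 'm"
  where "oblique_tangent_projection SU SV U V Z =
    oblique_left SU U ** Z - oblique_left SU U ** Z ** oblique_right SV V + Z ** oblique_right SV V"

definition is_factorization ::
    "real ^ 'n ^ 'm \<Rightarrow> real ^ 'r ^ 'm \<Rightarrow> real ^ 'r ^ 'r \<Rightarrow> real ^ 'r ^ 'n \<Rightarrow> bool"
  where "is_factorization Y U \<Sigma> V \<longleftrightarrow>
    orthonormal_columns U \<and> orthonormal_columns V \<and> Y = U ** \<Sigma> ** transpose V"

text \<open>
  \<open>deim_field_value SU SV F Y W\<close>: some factorization of \<open>Y\<close> yields the value \<open>W\<close> for the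
  projection of \<open>F Y\<close>. Well-definedness says that \<open>W\<close> does not depend on the factorization.
\<close>

definition deim_field_value ::
    "(real ^ 'r ^ 'm \<Rightarrow> real ^ 'r ^ 'm) \<Rightarrow> (real ^ 'r ^ 'n \<Rightarrow> real ^ 'r ^ 'n) \<Rightarrow>
     (real ^ 'n ^ 'm \<Rightarrow> real ^ 'n ^ 'm) \<Rightarrow> real ^ 'n ^ 'm \<Rightarrow> real ^ 'n ^ 'm \<Rightarrow> bool"
  where "deim_field_value SU SV F Y W \<longleftrightarrow>
    (\<exists>U \<Sigma> V. is_factorization Y U \<Sigma> V \<and> W = oblique_tangent_projection SU SV U V (F Y))"

definition deim_field_well_defined ::
    "(real ^ 'r ^ 'm \<Rightarrow> real ^ 'r ^ 'm) \<Rightarrow> (real ^ 'r ^ 'n \<Rightarrow> real ^ 'r ^ 'n) \<Rightarrow>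
     (real ^ 'n ^ 'm \<Rightarrow> real ^ 'n ^ 'm) \<Rightarrow> bool"
  where "deim_field_well_defined SU SV F \<longleftrightarrow>
    (\<forall>Y \<in> fixed_rank CARD('r). \<exists>!W. deim_field_value SU SV F Y W)"

definition deim_field ::
    "(real ^ 'r ^ 'm \<Rightarrow> real ^ 'r ^ 'm) \<Rightarrow> (real ^ 'r ^ 'n \<Rightarrow> real ^ 'r ^ 'n) \<Rightarrow>
     (real ^ 'n ^ 'm \<Rightarrow> real ^ 'n ^ 'm) \<Rightarrow> real ^ 'n ^ 'm \<Rightarrow> real ^ 'n ^ 'm"
  where "deim_field SU SV F Y = (THE W. deim_field_value SU SV F Y W)"

text \<open>Here \<open>cball Y \<epsilon>\<close> is \<open>Y + \<epsilon>B\<close> with \<open>B\<close> the closed Frobenius unit ball.\<close>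

definition filippov_on ::
    "'a::real_normed_vector set \<Rightarrow> ('a \<Rightarrow> 'b::real_normed_vector) \<Rightarrow> 'a \<Rightarrow> 'b set"
  where "filippov_on M f Y = (\<Inter>\<epsilon>\<in>{0<..}. closure (convex hull (f ` (cball Y \<epsilon> \<inter> M))))"

text \<open>
  The library constant \<open>absolutely_continuous\<close> concerns measures; this is the notion for functions.
\<close>

definition absolutely_continuous_on_interval ::
    "real \<Rightarrow> real \<Rightarrow> (real \<Rightarrow> 'a::real_normed_vector) \<Rightarrow> bool"
  where "absolutely_continuous_on_interval a b f \<longleftrightarrow>
    (\<forall>\<epsilon>>0. \<exists>\<delta>>0. \<forall>(N::nat) s t.
       (\<forall>i<N. a \<le> s i \<and> s i \<le> t i \<and> t i \<le> b) \<longrightarrow>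
       disjoint_family_on (\<lambda>i. {s i<..<t i}) {..<N} \<longrightarrow>
       (\<Sum>i<N. t i - s i) < \<delta> \<longrightarrow>
       (\<Sum>i<N. norm (f (t i) - f (s i))) < \<epsilon>)"

definition inclusion_solution ::
    "'a::real_normed_vector set \<Rightarrow> ('a \<Rightarrow> 'a set) \<Rightarrow> 'a \<Rightarrow> real \<Rightarrow> (real \<Rightarrow> 'a) \<Rightarrow> bool"
  where "inclusion_solution M G Y0 tmax Y \<longleftrightarrow>
    (\<forall>t\<in>{0..<tmax}. Y t \<in> M) \<and>
    (\<forall>T\<in>{0..<tmax}. absolutely_continuous_on_interval 0 T Y) \<and>
    Y 0 = Y0 \<and>
    (AE t in lebesgue. t \<in> {0..<tmax} \<longrightarrow>
       (\<exists>D. (Y has_vector_derivative D) (at t) \<and> D \<in> G (Y t)))"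

end

theory Submission
  imports Defs
begin

text \<open>
  The matrices of rank \<open>r\<close> within Frobenius distance \<open>\<rho> < \<sigma>\<^sub>r(Y0)\<close> of \<open>Y0\<close> form a compact set, and the
  field \<open>f\<close> is bounded by some \<open>L < 2 Cm Cn B\<close>, strictly, so one can go beyond \<open>t1\<close> before leaving
  this set. The field has the form \<open>f(Y) = P Y + Y Q\<close>, hence \<open>(I + h P) Y (I + h Q)\<close> is an Euler
  step that stays on the manifold with local error \<open>O(h\<^sup>2)\<close>. Cluster points of the Euler step
  functions for pointwise convergence (Tychonoff) are \<open>L\<close>-Lipschitz curves whose difference quotients
  lie in the closed convex hull of nearby values of \<open>f\<close>. Such a curve is differentiable almost
  everywhere, and its derivative is then in the Filippov set; no weak convergence of derivatives is
  needed.
\<close>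

section \<open>Almost everywhere differentiability of Lipschitz curves\<close>

text \<open>The selected rows and columns may jump with \<open>Y\<close>, so \<open>f\<close> need
  not be continuous; what survives the limit is that an Euler increment is, up to a small error, the
  elapsed time multiplied by an average of values of \<open>f\<close>. The matrices of rank
  \<open>r\<close> are not closed either. On the ball of radius \<rho> < \<sigma> = \<sigma>_r(Y0),
  however, every \<open>Y\<close> keeps the lower bound \<sigma> - \<rho> on the row space of
  \<open>Y0\<close>. Hence the rank cannot drop, membership becomes the closed condition that the
  rank is at most \<open>r\<close>, and the factors of the Euler step are bounded uniformly.

  The strict inequality \<open>tmax > t1\<close> is a matter of the constant \<open>L\<close>. With
  oblique projections P and R and Z = F(Y), the field is P Z (I - R) + Z R. The complement I - R
  obeys the same bound Cn as R, so the norm is at most Cm Cn B + Cn B, which is below 2 Cm Cn B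
  exactly if Cm > 1. If Cm = 1, then P is an orthogonal projection, and the form P Z + (I - P) Z R
  has orthogonal summands, with norm at most sqrt 2 Cn B.\<close>

lemma emeasure_disjoint_UN_le:
  assumes "countable C" "disjoint_family_on X C" "sets M = sets N"
    and X: "\<And>i. i \<in> C \<Longrightarrow> X i \<in> sets N"
    and le: "\<And>i. i \<in> C \<Longrightarrow> emeasure M (X i) \<le> c * emeasure N (X i)"
  shows "emeasure M (\<Union>i\<in>C. X i) \<le> c * emeasure N (\<Union>i\<in>C. X i)"
proof -
  have "emeasure M (\<Union>i\<in>C. X i) = (\<integral>\<^sup>+i. emeasure M (X i) \<partial>count_space C)"
    using assms by (intro emeasure_UN_countable) auto
  also have "\<dots> \<le> (\<integral>\<^sup>+i. c * emeasure N (X i) \<partial>count_space C)"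
    using le by (intro nn_integral_mono) simp
  also have "\<dots> = c * (\<integral>\<^sup>+i. emeasure N (X i) \<partial>count_space C)"
    by (intro nn_integral_cmult) simp
  also have "(\<integral>\<^sup>+i. emeasure N (X i) \<partial>count_space C) = emeasure N (\<Union>i\<in>C. X i)"
    using assms by (intro emeasure_UN_countable [symmetric]) auto
  finally show ?thesis .
qed

text \<open>Two Vitali coverings are compared through the Stieltjes measure \<mu> of
  \<open>F\<close>. Disjoint flat open intervals inside \<open>G\<close> cover almost all of
  \<open>E\<close> and form \<open>A\<close> with \<mu>(A) <= p |G|. Disjoint steep closed intervals
  inside \<open>A\<close> cover almost all of \<open>E \<inter> A\<close> and form \<open>B\<close>
  with q |B| <= \<mu>(B) <= \<mu>(A).\<close>

lemma steep_flat_cover: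
  fixes F :: "real \<Rightarrow> real"
  assumes mono: "\<And>x y. x \<le> y \<Longrightarrow> F x \<le> F y" and cont: "continuous_on UNIV F"
    and pq: "0 < p" "0 < q"
    and flat: "\<And>x d. x \<in> E \<Longrightarrow> 0 < d \<Longrightarrow>
      \<exists>u v. u < x \<and> x < v \<and> v - u < d \<and> F v - F u < p * (v - u)"
    and steep: "\<And>x d. x \<in> E \<Longrightarrow> 0 < d \<Longrightarrow>
      \<exists>u v. u \<le> x \<and> x \<le> v \<and> u < v \<and> v - u < d \<and> q * (v - u) < F v - F u"
    and G: "open G" "E \<subseteq> G"
  obtains B where "B \<in> sets borel" "negligible (E - B)"
    "ennreal q * emeasure lborel B \<le> ennreal p * emeasure lborel G"
proof -
  define \<mu> where "\<mu> = interval_measure F"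
  have ball: "ball c r = {c - r<..<c + r}" "cball c r = {c - r..c + r}" for c r :: real
    by (auto simp: dist_real_def)
  have Icc: "emeasure \<mu> {a..b} = F b - F a" if "a \<le> b" for a b
    unfolding \<mu>_def using that mono cont by (intro emeasure_interval_measure_Icc) auto
  define K where "K = {(c, r). 0 < r \<and> ball c r \<subseteq> G \<and> F (c + r) - F (c - r) < p * (2 * r)}"
  have "\<exists>i. i \<in> K \<and> x \<in> ball (fst i) (snd i) \<and> snd i < d" if "x \<in> E" "0 < d" for x d
  proof -
    obtain e where e: "0 < e" "ball x e \<subseteq> G"
      using G \<open>x \<in> E\<close> by (meson openE subsetD)
    obtain u v where uv: "u < x" "x < v" "v - u < min d e" "F v - F u < p * (v - u)"
      using flat [OF \<open>x \<in> E\<close>, of "min d e"] \<open>0 < d\<close> e by (metis min_less_iff_conj)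
    define c r where "c = (u + v) / 2" and "r = (v - u) / 2"
    have "u = c - r" "v = c + r" by (auto simp: c_def r_def field_simps)
    then have "ball c r \<subseteq> ball x e" "(c, r) \<in> K"
      using uv e by (auto simp: ball K_def subset_iff algebra_simps)
    then show ?thesis
      using uv by (intro exI [of _ "(c, r)"]) (auto simp: ball \<open>u = c - r\<close> \<open>v = c + r\<close>)
  qed
  then obtain C where C: "countable C" "C \<subseteq> K"
      "pairwise (\<lambda>i j. disjnt (ball (fst i) (snd i)) (ball (fst j) (snd j))) C"
      "negligible (E - (\<Union>i\<in>C. ball (fst i) (snd i)))"
    by (rule Vitali_covering_theorem_balls)
  define A where "A = (\<Union>i\<in>C. ball (fst i) (snd i))"
  have "emeasure \<mu> A \<le> ennreal p * emeasure lborel A"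
    unfolding A_def
  proof (rule emeasure_disjoint_UN_le)
    fix i assume "i \<in> C"
    then have i: "i \<in> K" using C by auto
    have "emeasure \<mu> (ball (fst i) (snd i)) \<le> emeasure \<mu> {fst i - snd i..fst i + snd i}"
      by (intro emeasure_mono) (auto simp: ball \<mu>_def)
    also have "\<dots> \<le> ennreal (p * (2 * snd i))"
      using i by (subst Icc) (auto simp: K_def intro!: ennreal_leI)
    also have "\<dots> = ennreal p * emeasure lborel (ball (fst i) (snd i))"
      using i pq by (auto simp: ball K_def ennreal_mult)
    finally show "emeasure \<mu> (ball (fst i) (snd i)) \<le> ennreal p * emeasure lborel (ball (fst i) (snd i))" .
  qed (use C in \<open>auto simp: \<mu>_def disjoint_family_on_def pairwise_def disjnt_def\<close>)
  also have "\<dots> \<le> ennreal p * emeasure lborel G"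
  proof (intro mult_left_mono emeasure_mono)
    show "A \<subseteq> G" using C(2) by (force simp: A_def K_def)
  qed (use G in auto)
  finally have 1: "emeasure \<mu> A \<le> ennreal p * emeasure lborel G" .
  define K' where "K' = {(c, r). 0 < r \<and> cball c r \<subseteq> A \<and> q * (2 * r) < F (c + r) - F (c - r)}"
  have cov: "\<exists>i. i \<in> K' \<and> x \<in> cball (fst i) (snd i) \<and> snd i < d" if "x \<in> E \<inter> A" "0 < d" for x d
  proof -
    have "open A" by (auto simp: A_def)
    then obtain e where e: "0 < e" "ball x e \<subseteq> A"
      using \<open>x \<in> E \<inter> A\<close> by (meson openE IntD2)
    obtain u v where uv: "u \<le> x" "x \<le> v" "u < v" "v - u < min d e" "q * (v - u) < F v - F u"
      using steep [of x "min d e"] \<open>0 < d\<close> \<open>x \<in> E \<inter> A\<close> e by (metis min_less_iff_conj IntD1)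
    define c r where "c = (u + v) / 2" and "r = (v - u) / 2"
    have "u = c - r" "v = c + r" by (auto simp: c_def r_def field_simps)
    then have "cball c r \<subseteq> ball x e" "(c, r) \<in> K'"
      using uv e by (auto simp: ball K'_def subset_iff algebra_simps)
    then show ?thesis
      using uv by (intro exI [of _ "(c, r)"]) (auto simp: ball \<open>u = c - r\<close> \<open>v = c + r\<close>)
  qed
  have pos: "0 < snd i" if "i \<in> K'" for i using that by (auto simp: K'_def)
  obtain D where D: "countable D" "D \<subseteq> K'"
      "pairwise (\<lambda>i j. disjnt (cball (fst i) (snd i)) (cball (fst j) (snd j))) D"
      "negligible (E \<inter> A - (\<Union>i\<in>D. cball (fst i) (snd i)))"
    by (rule Vitali_covering_theorem_cballs [of K' snd "E \<inter> A" fst, OF pos cov])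
  define B where "B = (\<Union>i\<in>D. cball (fst i) (snd i))"
  have "emeasure lborel B \<le> ennreal (1 / q) * emeasure \<mu> B"
    unfolding B_def
  proof (rule emeasure_disjoint_UN_le)
    fix i assume "i \<in> D"
    then have i: "i \<in> K'" using D by auto
    have "emeasure lborel (cball (fst i) (snd i)) = ennreal (2 * snd i)"
      using i by (auto simp: ball K'_def)
    also have "\<dots> \<le> ennreal ((1 / q) * (F (fst i + snd i) - F (fst i - snd i)))"
      using i pq by (intro ennreal_leI) (auto simp: K'_def field_simps)
    also have "\<dots> = ennreal (1 / q) * ennreal (F (fst i + snd i) - F (fst i - snd i))"
      using i pq by (intro ennreal_mult) (auto simp: K'_def intro!: mono)
    also have "\<dots> = ennreal (1 / q) * emeasure \<mu> (cball (fst i) (snd i))"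
      using i by (auto simp: ball Icc K'_def)
    finally show "emeasure lborel (cball (fst i) (snd i)) \<le> ennreal (1 / q) * emeasure \<mu> (cball (fst i) (snd i))" .
  qed (use D in \<open>auto simp: \<mu>_def disjoint_family_on_def pairwise_def disjnt_def\<close>)
  then have "ennreal q * emeasure lborel B \<le> ennreal q * (ennreal (1 / q) * emeasure \<mu> B)"
    by (intro mult_left_mono) auto
  also have "\<dots> = emeasure \<mu> B"
    using pq by (simp add: mult.assoc [symmetric] ennreal_mult [symmetric])
  also have "\<dots> \<le> emeasure \<mu> A"
  proof (intro emeasure_mono)
    show "B \<subseteq> A" using D(2) by (force simp: B_def K'_def)
    have "open A" by (auto simp: A_def)
    then show "A \<in> sets \<mu>" by (simp add: \<mu>_def)
  qed
  also note 1
  finally have 2: "ennreal q * emeasure lborel B \<le> ennreal p * emeasure lborel G" .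
  have "negligible (E - B)"
    by (rule negligible_subset [OF negligible_Un [OF C(4) D(4)]]) (auto simp: A_def B_def)
  moreover have "B \<in> sets borel"
    unfolding B_def using D(1) by (intro sets.countable_UN') auto
  ultimately show thesis using that 2 by blast
qed

text \<open>The covering would shrink the outer measure: if \<open>s\<close> > 0 were that of
  \<open>E\<close>, an open \<open>G\<close> containing \<open>E\<close> of measure below s q/p
  would yield a \<open>B\<close> of measure below \<open>s\<close> containing almost all of
  \<open>E\<close>. Boundedness of \<open>E\<close> makes \<open>s\<close> finite.\<close>

lemma steep_flat_negligible:
  fixes F :: "real \<Rightarrow> real"
  assumes mono: "\<And>x y. x \<le> y \<Longrightarrow> F x \<le> F y" and cont: "continuous_on UNIV F"
    and pq: "0 < p" "p < q" and "bounded E"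
    and flat: "\<And>x d. x \<in> E \<Longrightarrow> 0 < d \<Longrightarrow>
      \<exists>u v. u < x \<and> x < v \<and> v - u < d \<and> F v - F u < p * (v - u)"
    and steep: "\<And>x d. x \<in> E \<Longrightarrow> 0 < d \<Longrightarrow>
      \<exists>u v. u \<le> x \<and> x \<le> v \<and> u < v \<and> v - u < d \<and> q * (v - u) < F v - F u"
  shows "negligible E"
proof (rule ccontr)
  assume "\<not> negligible E"
  then obtain e where e: "0 < e" "\<And>T. E \<subseteq> T \<Longrightarrow> T \<in> lmeasurable \<Longrightarrow> e \<le> measure lebesgue T"
    by (auto simp: negligible_outer not_less)
  define S where "S = measure lebesgue ` {T. E \<subseteq> T \<and> T \<in> lmeasurable}"
  define s where "s = Inf S"
  have bdd: "bdd_below S" unfolding S_def by (rule bdd_belowI [of _ 0]) auto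
  obtain r where "E \<subseteq> cball 0 r"
    using bounded_subset_ballD [OF \<open>bounded E\<close>, of 0] by (meson ball_subset_cball order_trans)
  then have "S \<noteq> {}" unfolding S_def by (auto intro!: exI [of _ "cball 0 r"])
  have "e \<le> s" unfolding s_def using \<open>S \<noteq> {}\<close> e by (intro cInf_greatest) (auto simp: S_def)
  then have "s < s * (q / p)" using e pq by (simp add: field_simps)
  then obtain T where T: "E \<subseteq> T" "T \<in> lmeasurable" "measure lebesgue T < s * (q / p)"
    using cInf_lessD [OF \<open>S \<noteq> {}\<close>, of "s * (q / p)"] unfolding s_def S_def by auto
  obtain G where G: "open G" "T \<subseteq> G" "G - T \<in> lmeasurable"
      "emeasure lebesgue (G - T) < ennreal (s * (q / p) - measure lebesgue T)"
    using sets_lebesgue_outer_open [of T "s * (q / p) - measure lebesgue T"] T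
    by (auto simp: fmeasurableD)
  have "measure lebesgue (G - T) < s * (q / p) - measure lebesgue T"
    using G(3,4) T(3) by (simp add: emeasure_eq_measure2 ennreal_less_iff del: times_divide_eq_right)
  moreover have "T \<union> (G - T) = G" using G by auto
  ultimately have G': "G \<in> lmeasurable" "measure lebesgue G < s * (q / p)"
    using fmeasurable.Un [OF T(2) G(3)] measure_Un_le [of T lebesgue "G - T"] T(2) G(3)
    by (auto simp: fmeasurableD)
  obtain B where B: "B \<in> sets borel" "negligible (E - B)"
    "ennreal q * emeasure lborel B \<le> ennreal p * emeasure lborel G"
        by (rule steep_flat_cover [of F p q E G, OF mono cont _ _ flat steep \<open>open G\<close>])
      (use pq T G in \<open>auto intro: less_trans\<close>)
  have em: "emeasure lborel X = ennreal (measure lebesgue X)"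
    if "X \<in> lmeasurable" "X \<in> sets borel" for X
    using emeasure_eq_measure2 [OF that(1)] that(2) by simp
  have GG: "emeasure lborel G = ennreal (measure lebesgue G)"
    by (rule em) (use G' G(1) in auto)
  have "emeasure lborel B < \<infinity>"
  proof (rule ccontr)
    assume "\<not> emeasure lborel B < \<infinity>"
    then have "emeasure lborel B = \<infinity>" by (metis infinity_ennreal_def top.not_eq_extremum)
    then show False using B(3) pq by (simp add: GG ennreal_mult_top ennreal_mult[symmetric] top_unique)
  qed
  then have Bm: "B \<in> lmeasurable" using B(1) by (simp add: fmeasurable_def)
  then have "emeasure lborel B = ennreal (measure lebesgue B)"
    using B(1) by (rule em)
  then have "q * measure lebesgue B \<le> p * measure lebesgue G"
    using B(3) pq by (simp add: GG ennreal_mult[symmetric])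
  also have "\<dots> < p * (s * (q / p))" using G' pq by (intro mult_strict_left_mono)
  finally have "measure lebesgue B < s" using pq by simp
  moreover have "s \<le> measure lebesgue (B \<union> (E - B))"
    unfolding s_def
  proof (rule cInf_lower [OF _ bdd])
    have "B \<union> (E - B) \<in> lmeasurable"
      by (intro fmeasurable.Un Bm negligible_imp_measurable B)
    then show "measure lebesgue (B \<union> (E - B)) \<in> S"
      unfolding S_def by (intro imageI) blast
  qed
  moreover have "measure lebesgue (B \<union> (E - B)) = measure lebesgue B"
    using B Bm by (metis measure_Un_null_set fmeasurableD negligible_iff_null_sets)
  ultimately show False by simp
qed

text \<open>Without a limit the lower and the upper limit differ, and two thresholds fit between
  them. They are taken rational so that the exceptional points form a countable union of
  sets.\<close>

lemma bounded_not_convergent_oscillates: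
  fixes Q :: "'a \<Rightarrow> real"
  assumes ntriv: "G \<noteq> bot" and bd: "eventually (\<lambda>y. a \<le> Q y \<and> Q y \<le> b) G"
    and ndiff: "\<nexists>l. (Q \<longlongrightarrow> l) G"
  obtains p q where "p \<in> \<rat>" "q \<in> \<rat>" "p < q"
    "frequently (\<lambda>y. Q y < p) G" "frequently (\<lambda>y. q < Q y) G"
proof -
  let ?Q = "\<lambda>y. ereal (Q y)"
  have lo: "ereal a \<le> Liminf G ?Q"
    by (rule Liminf_bounded) (rule eventually_mono [OF bd], simp)
  have hi: "Limsup G ?Q \<le> ereal b"
    by (rule Limsup_bounded) (rule eventually_mono [OF bd], simp)
  have "Liminf G ?Q < Limsup G ?Q"
  proof (rule ccontr)
    assume "\<not> ?thesis"
    then have eq: "Limsup G ?Q = Liminf G ?Q"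
      using Liminf_le_Limsup [OF ntriv, of ?Q] by simp
    obtain l where l: "Liminf G ?Q = ereal l"
      using lo hi eq by (cases "Liminf G ?Q") auto
    then have "(?Q \<longlongrightarrow> ereal l) G"
      using tendsto_iff_Liminf_eq_Limsup [OF ntriv, of ?Q "ereal l"] eq by argo
    then show False using ndiff by auto
  qed
  then obtain p q where pq: "Liminf G ?Q < ereal (real_of_rat p)"
    "ereal (real_of_rat p) < ereal (real_of_rat q)" "ereal (real_of_rat q) < Limsup G ?Q"
    by (meson ereal_dense3)
  have "frequently (\<lambda>y. Q y < real_of_rat p) G"
  proof (rule ccontr)
    assume "\<not> ?thesis"
    then have "eventually (\<lambda>y. ereal (real_of_rat p) \<le> ?Q y) G"
      by (simp add: not_frequently not_less)
    then show False using Liminf_bounded [of "ereal (real_of_rat p)" ?Q G] pq(1) by (simp add: not_less [symmetric])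
  qed
  moreover have "frequently (\<lambda>y. real_of_rat q < Q y) G"
  proof (rule ccontr)
    assume "\<not> ?thesis"
    then have "eventually (\<lambda>y. ?Q y \<le> ereal (real_of_rat q)) G"
      by (simp add: not_frequently not_less)
    then show False using Limsup_bounded [of ?Q "ereal (real_of_rat q)" G] pq(3) by (simp add: not_less [symmetric])
  qed
  ultimately show thesis using pq(2) by (intro that [of "real_of_rat p" "real_of_rat q"]) auto
qed

text \<open>A linear term turns \<open>g\<close> into \<open>F\<close> with all slopes in
  [1, 2L + 1]. A point where the difference quotients of \<open>F\<close> have no limit sees slopes
  below some rational p > 0 and above some rational q > p at every scale, so it lies in one of
  countably many null sets.\<close>

lemma lipschitz_real_differentiable_AE:
  fixes g :: "real \<Rightarrow> real"
  assumes lip: "\<And>x y. \<bar>g x - g y\<bar> \<le> L * \<bar>x - y\<bar>"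
  shows "negligible {x. \<not> g differentiable (at x)}"
proof -
  define F where "F x = g x + (L + 1) * x" for x
  define Q where "Q x y = (F y - F x) / (y - x)" for x y
  have slope: "v - u \<le> F v - F u" "F v - F u \<le> (2 * L + 1) * (v - u)" if "u \<le> v" for u v
    using lip [of v u] that by (auto simp: F_def algebra_simps)
  have "0 \<le> L" using lip [of 1 0] by auto
  have mono: "F x \<le> F y" if "x \<le> y" for x y using slope(1) [OF that] that by simp
  have "L-lipschitz_on UNIV g"
    using lip \<open>0 \<le> L\<close> by (intro lipschitz_onI) (auto simp: dist_real_def)
  then have "continuous_on UNIV g" by (rule lipschitz_on_continuous_on)
  then have cont: "continuous_on UNIV F" unfolding F_def by (intro continuous_intros)
  define E where "E p q = {x. frequently (\<lambda>y. Q x y < p) (at x) \<and> frequently (\<lambda>y. q < Q x y) (at x)}" for p q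
  have Qbd: "1 \<le> Q x y" "Q x y \<le> 2 * L + 1" if "y \<noteq> x" for x y
    using that slope [of x y] slope [of y x] by (cases "x < y"; auto simp: Q_def field_simps)+
  have neg: "negligible (E p q \<inter> cball 0 (real n))" if "0 < p" "p < q" for p q n
  proof (rule steep_flat_negligible [OF mono cont that])
    fix x d :: real assume x: "x \<in> E p q \<inter> cball 0 (real n)" and "0 < d"
    have near: "eventually (\<lambda>y. y \<noteq> x \<and> \<bar>y - x\<bar> < d / 2) (at x)"
      unfolding eventually_at using \<open>0 < d\<close> by (intro exI [of _ "d / 2"]) (auto simp: dist_real_def)
    have "frequently (\<lambda>y. Q x y < p \<and> y \<noteq> x \<and> \<bar>y - x\<bar> < d / 2) (at x)"
      using x near by (intro frequently_eventually_frequently) (auto simp: E_def)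
    then obtain y where y: "Q x y < p" "y \<noteq> x" "\<bar>y - x\<bar> < d / 2"
      by (auto dest: frequently_ex)
    have contx: "(F \<longlongrightarrow> F x) (at x)" using cont by (simp add: continuous_on_def)
    \<comment> \<open>The quotient at \<open>y\<close> only gives a flat interval with
      \<open>x\<close> as an endpoint. By continuity of \<open>F\<close> this endpoint can be moved
      slightly beyond \<open>x\<close>, since the covering by open intervals needs \<open>x\<close>
      in the interior.\<close>
    show "\<exists>u v. u < x \<and> x < v \<and> v - u < d \<and> F v - F u < p * (v - u)"
    proof (cases "x < y")
      case True
      have "((\<lambda>u. F y - F u - p * (y - u)) \<longlongrightarrow> F y - F x - p * (y - x)) (at_left x)"
        by (intro tendsto_intros filterlim_mono [OF contx order_refl]) (simp add: at_le)
      moreover have "F y - F x - p * (y - x) < 0" using y True by (simp add: Q_def field_simps)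
      ultimately have "eventually (\<lambda>u. F y - F u - p * (y - u) < 0) (at_left x)"
        by (rule order_tendstoD(2))
      moreover have "eventually (\<lambda>u. u \<in> {x - d / 2<..<x}) (at_left x)"
        using \<open>0 < d\<close> by (intro eventually_at_left_real) simp
      ultimately obtain u where "F y - F u - p * (y - u) < 0" "x - d / 2 < u" "u < x"
        using eventually_happens [OF eventually_conj] by force
      then show ?thesis using y True by (intro exI [of _ u] exI [of _ y]) auto
    next
      case False
      then have "y < x" using y by simp
      have "((\<lambda>v. F v - F y - p * (v - y)) \<longlongrightarrow> F x - F y - p * (x - y)) (at_right x)"
        by (intro tendsto_intros filterlim_mono [OF contx order_refl]) (simp add: at_le)
      moreover have "F x - F y - p * (x - y) < 0" using y \<open>y < x\<close> by (simp add: Q_def field_simps)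
      ultimately have "eventually (\<lambda>v. F v - F y - p * (v - y) < 0) (at_right x)"
        by (rule order_tendstoD(2))
      moreover have "eventually (\<lambda>v. v \<in> {x<..<x + d / 2}) (at_right x)"
        using \<open>0 < d\<close> by (intro eventually_at_right_real) simp
      ultimately obtain v where "F v - F y - p * (v - y) < 0" "x < v" "v < x + d / 2"
        using eventually_happens [OF eventually_conj] by force
      then show ?thesis using y \<open>y < x\<close> by (intro exI [of _ y] exI [of _ v]) auto
    qed
    have "frequently (\<lambda>y. q < Q x y \<and> y \<noteq> x \<and> \<bar>y - x\<bar> < d / 2) (at x)"
      using x near by (intro frequently_eventually_frequently) (auto simp: E_def)
    then obtain z where z: "q < Q x z" "z \<noteq> x" "\<bar>z - x\<bar> < d / 2"
      by (auto dest: frequently_ex)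
    show "\<exists>u v. u \<le> x \<and> x \<le> v \<and> u < v \<and> v - u < d \<and> q * (v - u) < F v - F u"
      using z \<open>0 < d\<close>
      by (intro exI [of _ "min x z"] exI [of _ "max x z"])
        (auto simp: Q_def min_def max_def field_simps split: if_splits)
  qed (auto intro: bounded_subset [OF bounded_cball])
  define I :: "(real \<times> real \<times> nat) set" where "I = {(p, q, n). p \<in> \<rat> \<and> q \<in> \<rat> \<and> 0 < p \<and> p < q}"
  have "I \<subseteq> \<rat> \<times> \<rat> \<times> UNIV" by (auto simp: I_def)
  then have "countable I" by (rule countable_subset) (intro countable_SIGMA countable_rat; simp)
  then have "negligible (\<Union>(p, q, n)\<in>I. E p q \<inter> cball 0 (real n))"
    by (intro negligible_countable_Union) (auto simp: I_def neg)
  moreover have "{x. \<not> g differentiable (at x)} \<subseteq> (\<Union>(p, q, n)\<in>I. E p q \<inter> cball 0 (real n))"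
  proof clarify
    fix x assume "\<not> g differentiable (at x)"
    have nl: "\<nexists>l. (Q x \<longlongrightarrow> l) (at x)"
    proof
      assume "\<exists>l. (Q x \<longlongrightarrow> l) (at x)"
      then obtain l where "(F has_real_derivative l) (at x)"
        by (auto simp: has_field_derivative_iff Q_def [abs_def])
      then have "((\<lambda>x. F x - (L + 1) * x) has_real_derivative l - (L + 1)) (at x)"
        by (auto intro!: derivative_eq_intros)
      moreover have "(\<lambda>x. F x - (L + 1) * x) = g" by (auto simp: F_def)
      ultimately show False using \<open>\<not> g differentiable (at x)\<close>
        by (auto simp: real_differentiable_def)
    qed
    have bd: "eventually (\<lambda>y. 1 \<le> Q x y \<and> Q x y \<le> 2 * L + 1) (at x)"
      unfolding eventually_at using Qbd by (intro exI [of _ 1]) auto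
    obtain p q where pq: "p \<in> \<rat>" "q \<in> \<rat>" "p < q"
        "frequently (\<lambda>y. Q x y < p) (at x)" "frequently (\<lambda>y. q < Q x y) (at x)"
      by (rule bounded_not_convergent_oscillates [OF _ bd nl]) simp
    have "0 < p"
    proof (rule ccontr)
      assume "\<not> 0 < p"
      then have "eventually (\<lambda>y. \<not> Q x y < p) (at x)"
        unfolding eventually_at using Qbd(1) by (intro exI [of _ 1]) force
      then show False using pq(4) by (simp add: frequently_def)
    qed
    obtain n where "\<bar>x\<bar> \<le> real n" using real_arch_simple by blast
    then show "x \<in> (\<Union>(p, q, n)\<in>I. E p q \<inter> cball 0 (real n))"
      using pq \<open>0 < p\<close> by (intro UN_I [of "(p, q, n)"]) (auto simp: I_def E_def)
  qed
  ultimately show ?thesis by (rule negligible_subset)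
qed

lemma lipschitz_differentiable_AE:
  fixes g :: "real \<Rightarrow> 'a::euclidean_space"
  assumes lip: "\<And>x y. norm (g x - g y) \<le> L * \<bar>x - y\<bar>"
  shows "negligible {x. \<not> g differentiable (at x)}"
proof -
  have "negligible (\<Union>b\<in>Basis. {x. \<not> (\<lambda>x. g x \<bullet> b) differentiable (at x)})"
  proof (intro negligible_Union, simp, clarify)
    fix b :: 'a assume b: "b \<in> Basis"
    show "negligible {x. \<not> (\<lambda>x. g x \<bullet> b) differentiable (at x)}"
    proof (rule lipschitz_real_differentiable_AE [of _ L])
      fix x y
      have "\<bar>g x \<bullet> b - g y \<bullet> b\<bar> \<le> norm (g x - g y)"
        using Basis_le_norm [OF b, of "g x - g y"] by (simp add: inner_diff_left)
      then show "\<bar>g x \<bullet> b - g y \<bullet> b\<bar> \<le> L * \<bar>x - y\<bar>" using lip [of x y] by simp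
    qed
  qed
  then show ?thesis
    by (rule negligible_subset) (auto simp: differentiable_componentwise_within [of g])
qed

section \<open>Existence for Filippov inclusions via Euler schemes\<close>

text \<open>Tychonoff's theorem in the space of all functions with values in the sets
  \<open>K t\<close>. Neighbourhoods in the product topology control finitely many coordinates at
  once, and two of them suffice for a difference quotient.\<close>

lemma pointwise_cluster_point:
  fixes g :: "'i \<Rightarrow> 'b \<Rightarrow> 'a::metric_space"
  assumes "F \<noteq> bot" and K: "\<And>t. compact (K t)" and ev: "eventually (\<lambda>i. \<forall>t. g i t \<in> K t) F"
  obtains Y where "\<And>P t s e. eventually P F \<Longrightarrow> 0 < e \<Longrightarrow>
    \<exists>i. P i \<and> dist (g i t) (Y t) < e \<and> dist (g i s) (Y s) < e"
proof -
  have "compactin (product_topology (\<lambda>i. euclidean) UNIV) (PiE UNIV K)"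
    using K by (simp add: compactin_PiE)
  then have "compact (PiE UNIV K)"
    by (simp add: euclidean_product_topology)
  moreover have "eventually (\<lambda>x. x \<in> PiE UNIV K) (filtermap g F)"
    using ev by (simp add: eventually_filtermap PiE_iff)
  ultimately obtain Y where Y: "inf (nhds Y) (filtermap g F) \<noteq> bot"
    using \<open>F \<noteq> bot\<close> by (force simp: compact_filter filtermap_bot_iff)
  show thesis
  proof (rule that [of Y], rule ccontr)
    fix P t s and e :: real
    assume P: "eventually P F" and "0 < e"
      and no: "\<not> (\<exists>i. P i \<and> dist (g i t) (Y t) < e \<and> dist (g i s) (Y s) < e)"
    let ?N = "{\<phi>. dist (\<phi> t) (Y t) < e \<and> dist (\<phi> s) (Y s) < e}"
    have "open ?N"
      by (intro open_Collect_conj open_Collect_less continuous_intros continuous_on_product_coordinates)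
    then have "eventually (\<lambda>\<phi>. \<phi> \<in> ?N) (nhds Y)"
      using \<open>0 < e\<close> by (intro eventually_nhds_in_open) auto
    moreover have "eventually (\<lambda>\<phi>. \<phi> \<notin> ?N) (filtermap g F)"
      unfolding eventually_filtermap using P by (rule eventually_mono) (use no in auto)
    ultimately have "eventually (\<lambda>_. False) (inf (nhds Y) (filtermap g F))"
      unfolding eventually_inf by (intro exI [of _ "\<lambda>\<phi>. \<phi> \<in> ?N"] exI [of _ "\<lambda>\<phi>. \<phi> \<notin> ?N"]) auto
    then show False using Y by (simp add: eventually_False)
  qed
qed

text \<open>The increment telescopes, and \<open>w\<close> is the average of the
  \<open>b - a\<close> values \<open>f (y j)\<close>, a convex combination with equal
  weights.\<close>

lemma euler_increment_in_hull:
  fixes y :: "nat \<Rightarrow> 'a::real_normed_vector"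
  assumes "a < b" and S: "\<And>j. a \<le> j \<Longrightarrow> j < b \<Longrightarrow> y j \<in> S"
    and err: "\<And>j. a \<le> j \<Longrightarrow> j < b \<Longrightarrow> norm (y (Suc j) - y j - h *\<^sub>R f (y j)) \<le> E"
  obtains w where "w \<in> convex hull (f ` S)"
    "norm (y b - y a - ((real b - real a) * h) *\<^sub>R w) \<le> (real b - real a) * E"
proof -
  define w where "w = (\<Sum>j = a..<b. (1 / (real b - real a)) *\<^sub>R f (y j))"
  have "w \<in> convex hull (f ` S)"
    unfolding w_def using assms(1) S
    by (intro convex_sum) (auto intro!: hull_inc simp: of_nat_diff)
  have "((real b - real a) * h) *\<^sub>R w = (\<Sum>j = a..<b. h *\<^sub>R f (y j))"
    unfolding w_def scaleR_sum_right using assms(1) by (intro sum.cong) auto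
  moreover have "y b - y a = (\<Sum>j = a..<b. y (Suc j) - y j)"
    using assms(1) by (simp add: sum_Suc_diff')
  ultimately have "y b - y a - ((real b - real a) * h) *\<^sub>R w
      = (\<Sum>j = a..<b. y (Suc j) - y j - h *\<^sub>R f (y j))"
    by (simp add: sum_subtractf)
  also have "norm \<dots> \<le> (\<Sum>j = a..<b. E)"
    using err by (intro sum_norm_le) auto
  also have "\<dots> = (real b - real a) * E" using assms(1) by (simp add: of_nat_diff)
  finally show thesis using that \<open>w \<in> _\<close> by blast
qed

lemma lipschitz_imp_absolutely_continuous_on_interval:
  assumes "0 \<le> L" and lip: "\<And>x y. norm (f x - f y) \<le> L * \<bar>x - y\<bar>"
  shows "absolutely_continuous_on_interval a b f"
  unfolding absolutely_continuous_on_interval_def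
proof (intro allI impI)
  fix e :: real assume "0 < e"
  show "\<exists>\<delta>>0. \<forall>(N::nat) s t. (\<forall>i<N. a \<le> s i \<and> s i \<le> t i \<and> t i \<le> b) \<longrightarrow>
       disjoint_family_on (\<lambda>i. {s i<..<t i}) {..<N} \<longrightarrow>
       (\<Sum>i<N. t i - s i) < \<delta> \<longrightarrow> (\<Sum>i<N. norm (f (t i) - f (s i))) < e"
  proof (intro exI [of _ "e / (L + 1)"] conjI allI impI)
    show "0 < e / (L + 1)" using \<open>0 < e\<close> assms by simp
    fix N :: nat and s t :: "nat \<Rightarrow> real" assume st: "\<forall>i<N. a \<le> s i \<and> s i \<le> t i \<and> t i \<le> b"
      and "disjoint_family_on (\<lambda>i. {s i<..<t i}) {..<N}"
      and small: "(\<Sum>i<N. t i - s i) < e / (L + 1)"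
    have "(\<Sum>i<N. norm (f (t i) - f (s i))) \<le> (\<Sum>i<N. (L + 1) * (t i - s i))"
    proof (rule sum_mono)
      fix i assume "i \<in> {..<N}"
      then show "norm (f (t i) - f (s i)) \<le> (L + 1) * (t i - s i)"
        using lip [of "t i" "s i"] st by (force simp: algebra_simps)
    qed
    also have "\<dots> < e"
      using small \<open>0 \<le> L\<close> by (simp add: sum_distrib_left [symmetric] pos_less_divide_eq mult.commute)
    finally show "(\<Sum>i<N. norm (f (t i) - f (s i))) < e" .
  qed
qed

section \<open>The Euler scheme in a closed piece of the constraint set\<close>

text \<open>A step \<open>y'\<close> may leave the ball, and in the application the rank of
  \<open>y'\<close> is known from below only inside it, so \<open>step\<close> promises membership
  in \<open>M\<close> only there. The gap in \<open>L * T < \<rho>\<close> pays for the local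
  errors, so that all iterates up to time \<open>T\<close> stay in the ball.\<close>

locale euler_scheme =
  fixes f :: "'a::euclidean_space \<Rightarrow> 'a" and M :: "'a set" and y0 :: 'a and \<rho> L C T :: real
  assumes y0: "y0 \<in> M" and closed: "closed (M \<inter> cball y0 \<rho>)"
    and bound: "\<And>y. y \<in> M \<inter> cball y0 \<rho> \<Longrightarrow> norm (f y) \<le> L"
    and step: "\<And>y h. y \<in> M \<inter> cball y0 \<rho> \<Longrightarrow> 0 < h \<Longrightarrow> h \<le> 1 \<Longrightarrow>
      \<exists>y'. norm (y' - y - h *\<^sub>R f y) \<le> C * h\<^sup>2 \<and> (y' \<in> cball y0 \<rho> \<longrightarrow> y' \<in> M)"
    and pos: "0 < L" "0 \<le> C" "0 < T" "L * T < \<rho>"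
begin

abbreviation "K \<equiv> M \<inter> cball y0 \<rho>"

text \<open>The sum \<open>L + C * h\<close> is the speed of the scheme: the bound on the field plus
  the local error \<open>C * h\<^sup>2\<close> divided by the step size.\<close>

definition good :: "real \<Rightarrow> bool"
  where "good h \<longleftrightarrow> 0 < h \<and> h \<le> 1 \<and> T * (L + C * h) \<le> \<rho>"

text \<open>Indices beyond time \<open>T\<close> are left free, so that infinite sequences can be
  used whatever the step size.\<close>

definition euler :: "real \<Rightarrow> (nat \<Rightarrow> 'a) \<Rightarrow> bool"
  where "euler h y \<longleftrightarrow> y 0 = y0 \<and> (\<forall>j. real j * h \<le> T \<longrightarrow> y j \<in> K) \<and>
    (\<forall>j. real (Suc j) * h \<le> T \<longrightarrow> norm (y (Suc j) - y j - h *\<^sub>R f (y j)) \<le> C * h\<^sup>2)"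

lemma euler_exists:
  assumes "good h"
  shows "\<exists>y. euler h y"
proof -
  have h: "0 < h" "h \<le> 1" "T * (L + C * h) \<le> \<rho>" using assms by (auto simp: good_def)
  \<comment> \<open>The invariant carries a distance bound growing linearly in time; it keeps the
    next iterate in the ball, where \<open>step\<close> yields membership in \<open>M\<close>.
    Beyond time \<open>T\<close> it is vacuous, so the choice never stops.\<close>
  define P where "P n y \<longleftrightarrow> (n = 0 \<longrightarrow> y = y0) \<and>
    (real n * h \<le> T \<longrightarrow> y \<in> M \<and> norm (y - y0) \<le> real n * h * (L + C * h))" for n y
  define Q where "Q n y y' \<longleftrightarrow>
    (real (Suc n) * h \<le> T \<longrightarrow> norm (y' - y - h *\<^sub>R f y) \<le> C * h\<^sup>2)" for n y y'
  have inK: "y \<in> K" if "P n y" "real n * h \<le> T" for n y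
  proof -
    have "real n * h * (L + C * h) \<le> T * (L + C * h)"
      using that pos h by (intro mult_right_mono) auto
    then show ?thesis using that h by (auto simp: P_def dist_norm norm_minus_commute)
  qed
  have "\<exists>y. \<forall>n. P n (y n) \<and> Q n (y n) (y (Suc n))"
  proof (rule dependent_nat_choice)
    show "\<exists>x. P 0 x" using y0 by (auto simp: P_def)
    fix y n assume P: "P n y"
    show "\<exists>y'. P (Suc n) y' \<and> Q n y y'"
    proof (cases "real (Suc n) * h \<le> T")
      case True
      then have le: "real n * h \<le> T" using h by (simp add: algebra_simps)
      obtain y' where y': "norm (y' - y - h *\<^sub>R f y) \<le> C * h\<^sup>2" "y' \<in> cball y0 \<rho> \<longrightarrow> y' \<in> M"
        using step [OF inK [OF P le] h(1,2)] by blast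
      have "norm (y' - y0) \<le> norm (y' - y - h *\<^sub>R f y) + (norm (y - y0) + norm (h *\<^sub>R f y))"
        using norm_triangle_ineq [of "y' - y - h *\<^sub>R f y" "(y - y0) + h *\<^sub>R f y"]
          norm_triangle_ineq [of "y - y0" "h *\<^sub>R f y"] by (simp add: algebra_simps)
      moreover have "norm (h *\<^sub>R f y) \<le> h * L"
        using bound [OF inK [OF P le]] h by simp
      moreover have "norm (y - y0) \<le> real n * h * (L + C * h)" using P le by (simp add: P_def)
      ultimately have "norm (y' - y0) \<le> C * h\<^sup>2 + (real n * h * (L + C * h) + h * L)"
        using y'(1) by linarith
      also have "\<dots> = real (Suc n) * h * (L + C * h)"
        by (simp add: algebra_simps power2_eq_square)
      finally have b: "norm (y' - y0) \<le> real (Suc n) * h * (L + C * h)" .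
      also have "\<dots> \<le> T * (L + C * h)" using True pos h by (intro mult_right_mono) auto
      finally have "y' \<in> M" using y'(2) h by (auto simp: dist_norm norm_minus_commute)
      then show ?thesis using b y' by (auto simp: P_def Q_def)
    qed (auto simp: P_def Q_def)
  qed
  then obtain y where y: "\<And>n. P n (y n)" "\<And>n. Q n (y n) (y (Suc n))" by blast
  have "y 0 = y0" using y(1) [of 0] by (simp add: P_def)
  then show ?thesis
    unfolding euler_def using y(2) inK [OF y(1)] by (intro exI [of _ y]) (auto simp: Q_def)
qed

lemma euler_increment:
  assumes "good h" "euler h y" "a \<le> b" "real b * h \<le> T"
  shows "norm (y b - y a) \<le> (real b - real a) * h * (L + C * h)"
  using assms(3,4)
proof (induction b rule: dec_induct)
  case base
  then show ?case by simp
next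
  case (step n)
  have h: "0 < h" using assms by (auto simp: good_def)
  have le: "real n * h \<le> T" using step.prems h by (simp add: algebra_simps)
  have "norm (y (Suc n) - y a) \<le> norm (y (Suc n) - y n - h *\<^sub>R f (y n)) + (norm (y n - y a) + norm (h *\<^sub>R f (y n)))"
    using norm_triangle_ineq [of "y (Suc n) - y n - h *\<^sub>R f (y n)" "(y n - y a) + h *\<^sub>R f (y n)"]
      norm_triangle_ineq [of "y n - y a" "h *\<^sub>R f (y n)"] by (simp add: algebra_simps)
  moreover have "norm (h *\<^sub>R f (y n)) \<le> h * L"
    using bound [of "y n"] assms(2) le h by (simp add: euler_def)
  moreover have "norm (y (Suc n) - y n - h *\<^sub>R f (y n)) \<le> C * h\<^sup>2"
    using assms(2) step.prems by (simp add: euler_def)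
  ultimately have "norm (y (Suc n) - y a) \<le> C * h\<^sup>2 + ((real n - real a) * h * (L + C * h) + h * L)"
    using step.IH [OF le] by linarith
  also have "\<dots> = (real (Suc n) - real a) * h * (L + C * h)"
    by (simp add: algebra_simps power2_eq_square)
  finally show ?case .
qed

lemma eventually_good: "eventually good (at_right 0)"
proof -
  have "((\<lambda>h. T * (L + C * h)) \<longlongrightarrow> T * (L + C * 0)) (at_right 0)" by (intro tendsto_intros)
  then have "eventually (\<lambda>h. T * (L + C * h) < \<rho>) (at_right 0)"
    by (rule order_tendstoD) (use pos in \<open>simp add: mult.commute\<close>)
  moreover have "eventually (\<lambda>h::real. h \<in> {0<..<1}) (at_right 0)"
    by (rule eventually_at_right_real) simp
  ultimately show ?thesis by eventually_elim (auto simp: good_def)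
qed

text \<open>Between the times \<open>t\<close> and \<open>s\<close> the iterates travel little more
  than \<open>L * (s - t)\<close>, so their increment is nearly \<open>s - t\<close> times an
  average of values of \<open>f\<close> near \<open>Y t\<close>. The slack \<open>e\<close> absorbs
  the error in the base points, the closure the error in the increment.\<close>

lemma limit_curve:
  obtains Y where "Y 0 = y0" "\<And>t. 0 \<le> t \<Longrightarrow> t \<le> T \<Longrightarrow> Y t \<in> K"
    "\<And>t s e. 0 \<le> t \<Longrightarrow> t < s \<Longrightarrow> s \<le> T \<Longrightarrow> 0 < e \<Longrightarrow>
      (Y s - Y t) /\<^sub>R (s - t) \<in> closure (convex hull (f ` (cball (Y t) (L * (s - t) + e) \<inter> K)))"
proof -
  obtain z where z: "\<And>h. good h \<Longrightarrow> euler h (z h)"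
    using euler_exists by metis
  define n where "n h t = nat \<lfloor>t / h\<rfloor>" for h t :: real
  \<comment> \<open>The value \<open>y0\<close> outside the time interval keeps \<open>g h t\<close>
    in \<open>K\<close> for every real \<open>t\<close>, so that one compact ball serves all
    coordinates.\<close>
  define g where "g h t = (if 0 \<le> t \<and> t \<le> T then z h (n h t) else y0)" for h t
  have n: "real (n h t) * h \<le> t" "t < (real (n h t) + 1) * h" if "good h" "0 \<le> t" for h t
  proof -
    have "real (n h t) \<le> t / h" "t / h < real (n h t) + 1" "0 < h"
      using that by (auto simp: n_def good_def)
    then show "real (n h t) * h \<le> t" "t < (real (n h t) + 1) * h" by (auto simp: field_simps)
  qed
  have "0 < \<rho>" using pos by (smt (verit) mult_pos_pos)
  have gK: "g h t \<in> K" if "good h" for h t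
    using z [OF that] n(1) [OF that, of t] y0 \<open>0 < \<rho>\<close> unfolding g_def euler_def by force
  have "eventually (\<lambda>h. \<forall>t. g h t \<in> cball y0 \<rho>) (at_right 0)"
    using eventually_good by (rule eventually_mono) (use gK in blast)
  then obtain Y where Y: "\<And>P t s e. eventually P (at_right 0) \<Longrightarrow> 0 < e \<Longrightarrow>
      \<exists>h. P h \<and> dist (g h t) (Y t) < e \<and> dist (g h s) (Y s) < e"
    by (rule pointwise_cluster_point [where K = "\<lambda>_. cball y0 \<rho>", rotated 2]) auto
  have YK: "Y t \<in> K" for t
  proof -
    have "Y t \<in> closure K"
      unfolding closure_approachable using Y [OF eventually_good] gK by blast
    then show ?thesis using closed by simp
  qed
  have "dist y0 (Y 0) < e" if "0 < e" for e
  proof -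
    obtain h where "good h" "dist (g h 0) (Y 0) < e"
      using Y [OF eventually_good \<open>0 < e\<close>, of 0 0] by blast
    moreover have "g h 0 = y0"
      using z [OF \<open>good h\<close>] pos by (simp add: g_def n_def euler_def)
    ultimately show ?thesis by simp
  qed
  then have "Y 0 = y0" by (metis dist_eq_0_iff less_irrefl zero_less_dist_iff)
  moreover have "(Y s - Y t) /\<^sub>R (s - t) \<in> closure (convex hull (f ` (cball (Y t) (L * (s - t) + e) \<inter> K)))"
    if ts: "0 \<le> t" "t < s" "s \<le> T" and "0 < e" for t s e
    unfolding closure_approachable
  proof (intro allI impI)
    fix \<eta> :: real assume "0 < \<eta>"
    define d where "d = s - t"
    have "0 < d" using ts by (simp add: d_def)
    have "((\<lambda>h. (d + h) * (L + C * h)) \<longlongrightarrow> (d + 0) * (L + C * 0)) (at_right 0)"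
      by (intro tendsto_intros)
    then have 1: "eventually (\<lambda>h. (d + h) * (L + C * h) < L * d + e / 2) (at_right 0)"
      by (rule order_tendstoD) (use \<open>0 < e\<close> in \<open>simp add: mult.commute\<close>)
    have "((\<lambda>h. (d + h) * C * h + h * L) \<longlongrightarrow> (d + 0) * C * 0 + 0 * L) (at_right 0)"
      by (intro tendsto_intros)
    then have 2: "eventually (\<lambda>h. (d + h) * C * h + h * L < \<eta> * d / 2) (at_right 0)"
      by (rule order_tendstoD) (use \<open>0 < \<eta>\<close> \<open>0 < d\<close> in simp)
    have 3: "eventually (\<lambda>h. h \<in> {0<..<d}) (at_right 0)"
      by (rule eventually_at_right_real) (use \<open>0 < d\<close> in simp)
    have ev: "eventually (\<lambda>h. good h \<and> h < d \<and> (d + h) * (L + C * h) < L * d + e / 2 \<and>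
        (d + h) * C * h + h * L < \<eta> * d / 2) (at_right 0)"
      using eventually_good 1 2 3 by eventually_elim auto
    \<comment> \<open>Error budget: the radius is \<open>L * d + e / 2\<close> for the travel of the
      iterates plus \<open>e / 2\<close> for the distance from \<open>Y t\<close> to the step
      function. The increment may be off by \<eta> d: a quarter at each endpoint and half for the
      scheme.\<close>
    have "0 < min (e / 2) (\<eta> * d / 4)" using \<open>0 < e\<close> \<open>0 < \<eta>\<close> \<open>0 < d\<close> by simp
    from Y [OF ev this, of t s] obtain h where h: "good h" "h < d"
        "(d + h) * (L + C * h) < L * d + e / 2" "(d + h) * C * h + h * L < \<eta> * d / 2"
        "dist (g h t) (Y t) < e / 2" "dist (g h t) (Y t) < \<eta> * d / 4" "dist (g h s) (Y s) < \<eta> * d / 4"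
      by auto
    have "0 < h" using h by (simp add: good_def)
    note E = z [OF h(1)]
    define a b where "a = n h t" and "b = n h s"
    have ga: "g h t = z h a" "g h s = z h b" using ts by (auto simp: g_def a_def b_def)
    have ab: "real a * h \<le> t" "t < (real a + 1) * h" "real b * h \<le> s" "s < (real b + 1) * h"
      using n [OF h(1)] ts by (auto simp: a_def b_def)
    have d1: "(real b - real a) * h \<le> d + h" "d - h \<le> (real b - real a) * h"
      using ab by (auto simp: d_def algebra_simps)
    have "a < b"
    proof (rule ccontr)
      assume "\<not> a < b"
      then have "(real b - real a) * h \<le> 0" using \<open>0 < h\<close> by (intro mult_nonpos_nonneg) auto
      then show False using d1 h(2) by simp
    qed
    have jT: "real j * h \<le> T" if "j \<le> b" for j
    proof -
      have "real j * h \<le> real b * h" using that \<open>0 < h\<close> by (intro mult_right_mono) auto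
      then show ?thesis using ab ts by simp
    qed
    have inS: "z h j \<in> cball (Y t) (L * d + e) \<inter> K" if j: "a \<le> j" "j < b" for j
    proof -
      have "norm (z h j - z h a) \<le> (real j - real a) * h * (L + C * h)"
        using euler_increment [OF h(1) E j(1)] jT j by simp
      also have "\<dots> \<le> (d + h) * (L + C * h)"
      proof (rule mult_right_mono)
        have "(real j - real a) * h \<le> (real b - real a) * h"
          using j \<open>0 < h\<close> by (intro mult_right_mono) auto
        then show "(real j - real a) * h \<le> d + h" using d1 by simp
      qed (use pos \<open>0 < h\<close> in simp)
      finally have "dist (z h j) (z h a) < L * d + e / 2" using h by (simp add: dist_norm)
      then have "dist (Y t) (z h j) \<le> L * d + e"
        using h(5) dist_triangle [of "Y t" "z h j" "z h a"] by (simp add: ga dist_commute)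
      then show ?thesis using E jT j by (simp add: euler_def)
    qed
    have err: "norm (z h (Suc j) - z h j - h *\<^sub>R f (z h j)) \<le> C * h\<^sup>2" if "a \<le> j" "j < b" for j
      using E jT [of "Suc j"] that by (simp add: euler_def)
    obtain w where w: "w \<in> convex hull (f ` (cball (Y t) (L * d + e) \<inter> K))"
      "norm (z h b - z h a - ((real b - real a) * h) *\<^sub>R w) \<le> (real b - real a) * (C * h\<^sup>2)"
      by (rule euler_increment_in_hull [where y = "z h" and f = f, OF \<open>a < b\<close> inS err])
    have "convex hull (f ` (cball (Y t) (L * d + e) \<inter> K)) \<subseteq> cball 0 L"
      using bound by (intro hull_minimal) auto
    then have wL: "norm w \<le> L" using w by auto
    have e1: "norm (((real b - real a) * h) *\<^sub>R w - d *\<^sub>R w) \<le> h * L"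
    proof -
      have "\<bar>(real b - real a) * h - d\<bar> \<le> h" using d1 by (simp add: abs_le_iff)
      then have "\<bar>(real b - real a) * h - d\<bar> * norm w \<le> h * L"
        using wL \<open>0 < h\<close> by (intro mult_mono) auto
      then show ?thesis by (simp add: scaleR_diff_left [symmetric])
    qed
    have "(real b - real a) * (C * h\<^sup>2) = ((real b - real a) * h) * (C * h)"
      by (simp add: power2_eq_square)
    also have "\<dots> \<le> (d + h) * (C * h)"
      using d1 pos \<open>0 < h\<close> by (intro mult_right_mono) auto
    finally have e2: "norm (z h b - z h a - ((real b - real a) * h) *\<^sub>R w) \<le> (d + h) * C * h"
      using w(2) by simp
    have "Y s - Y t - d *\<^sub>R w = (Y s - z h b) + (z h a - Y t) +
        ((z h b - z h a - ((real b - real a) * h) *\<^sub>R w) + (((real b - real a) * h) *\<^sub>R w - d *\<^sub>R w))"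
      by (simp add: algebra_simps)
    also have "norm \<dots> \<le> norm (Y s - z h b) + norm (z h a - Y t) +
        (norm (z h b - z h a - ((real b - real a) * h) *\<^sub>R w) + norm (((real b - real a) * h) *\<^sub>R w - d *\<^sub>R w))"
      by (intro norm_triangle_mono order_refl)
    also have "\<dots> < \<eta> * d"
      using h(4,6,7) e1 e2 by (simp add: ga dist_norm norm_minus_commute)
    finally have "norm (Y s - Y t - d *\<^sub>R w) < \<eta> * d" .
    moreover have eq: "w - (Y s - Y t) /\<^sub>R d = (- 1 / d) *\<^sub>R (Y s - Y t - d *\<^sub>R w)"
      using \<open>0 < d\<close> by (simp add: algebra_simps divide_simps)
    ultimately have "dist w ((Y s - Y t) /\<^sub>R d) < \<eta>"
      unfolding dist_norm eq norm_scaleR using \<open>0 < d\<close> by (simp add: pos_divide_less_eq)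
    then show "\<exists>w\<in>convex hull (f ` (cball (Y t) (L * (s - t) + e) \<inter> K)).
        dist w ((Y s - Y t) /\<^sub>R (s - t)) < \<eta>"
      using w(1) by (auto simp: d_def)
  qed
  ultimately show thesis using that YK by blast
qed

text \<open>At a point of differentiability the right difference quotients converge to
  \<open>D\<close>, and for each radius \<open>e\<close> the closed hull around the point eventually
  contains them all; hence \<open>D\<close> lies in the intersection over \<open>e\<close>.\<close>

lemma filippov_solution_exists: "\<exists>Y. inclusion_solution M (filippov_on M f) y0 T Y"
proof -
  obtain Y where Y: "Y 0 = y0" "\<And>t. 0 \<le> t \<Longrightarrow> t \<le> T \<Longrightarrow> Y t \<in> K"
    "\<And>t s e. 0 \<le> t \<Longrightarrow> t < s \<Longrightarrow> s \<le> T \<Longrightarrow> 0 < e \<Longrightarrow>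
      (Y s - Y t) /\<^sub>R (s - t) \<in> closure (convex hull (f ` (cball (Y t) (L * (s - t) + e) \<inter> K)))"
    using limit_curve by blast
  have lip_less: "norm (Y s - Y t) \<le> L * (s - t)" if "0 \<le> t" "t < s" "s \<le> T" for s t
  proof -
    have "closure (convex hull (f ` (cball (Y t) (L * (s - t) + 1) \<inter> K))) \<subseteq> cball 0 L"
      using bound by (intro closure_minimal hull_minimal) auto
    then have "norm ((Y s - Y t) /\<^sub>R (s - t)) \<le> L"
      using Y(3) [OF that, of 1] by (auto simp del: norm_scaleR)
    then have "norm (Y s - Y t) / (s - t) \<le> L"
      using that by (simp add: divide_inverse mult.commute)
    then show ?thesis using that by (simp add: pos_divide_le_eq)
  qed
  \<comment> \<open>Freezing the curve outside the time interval makes it Lipschitz on the whole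
    line, which is the form the differentiability theorem takes.\<close>
  define c where "c t = max 0 (min T t)" for t
  have c: "0 \<le> c t" "c t \<le> T" "\<bar>c t - c s\<bar> \<le> \<bar>t - s\<bar>" for s t using pos by (auto simp: c_def)
  define Z where "Z t = Y (c t)" for t
  have lip: "norm (Z x - Z y) \<le> L * \<bar>x - y\<bar>" for x y
  proof -
    have "norm (Z x - Z y) \<le> L * \<bar>c x - c y\<bar>"
      using lip_less [of "c y" "c x"] lip_less [of "c x" "c y"] c(1,2) [of x] c(1,2) [of y]
      by (cases "c x" "c y" rule: linorder_cases) (auto simp: Z_def norm_minus_commute)
    also have "\<dots> \<le> L * \<bar>x - y\<bar>" using c(3) pos by (intro mult_left_mono) auto
    finally show ?thesis .
  qed
  have ZY: "Z t = Y t" if "0 \<le> t" "t \<le> T" for t using that by (simp add: Z_def c_def)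
  have der: "\<exists>D. (Z has_vector_derivative D) (at t) \<and> D \<in> filippov_on M f (Z t)"
    if t: "0 < t" "t < T" and diff: "Z differentiable (at t)" for t
  proof -
    obtain D where D: "(Z has_vector_derivative D) (at t)"
      using diff vector_derivative_works by blast
    have "((\<lambda>s. (Z s - Z t - (s - t) *\<^sub>R D) /\<^sub>R \<bar>s - t\<bar>) \<longlongrightarrow> 0) (at_right t)"
      using has_vector_derivative_at_within [OF D, of "{t<..}"]
      by (simp add: has_vector_derivative_def has_derivative_within diff_diff_eq inverse_eq_divide)
    moreover have "eventually (\<lambda>s. (Z s - Z t - (s - t) *\<^sub>R D) /\<^sub>R \<bar>s - t\<bar> = (Z s - Z t) /\<^sub>R (s - t) - D) (at_right t)"
      using eventually_at_right_less [of t] by eventually_elim (simp add: scaleR_diff_right)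
    ultimately have "((\<lambda>s. (Z s - Z t) /\<^sub>R (s - t) - D) \<longlongrightarrow> 0) (at_right t)"
      by (simp cong: tendsto_cong)
    then have lim: "((\<lambda>s. (Z s - Z t) /\<^sub>R (s - t)) \<longlongrightarrow> D) (at_right t)"
      by (rule LIM_zero_cancel)
    have "D \<in> closure (convex hull (f ` (cball (Z t) e \<inter> M)))" if "0 < e" for e
    proof (rule Lim_in_closed_set [OF closed_closure _ _ lim])
      \<comment> \<open>The bound \<open>e / (2 * L)\<close> on \<open>s - t\<close> spends half of
        the radius on travel and leaves half for the slack.\<close>
      have "eventually (\<lambda>s. s \<in> {t<..<min T (t + e / (2 * L))}) (at_right t)"
        using t pos \<open>0 < e\<close> by (intro eventually_at_right_real) simp
      then show "eventually (\<lambda>s. (Z s - Z t) /\<^sub>R (s - t) \<in> closure (convex hull (f ` (cball (Z t) e \<inter> M)))) (at_right t)"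
      proof (rule eventually_mono)
        fix s assume s: "s \<in> {t<..<min T (t + e / (2 * L))}"
        have "L * (s - t) + e / 2 \<le> e" using s pos by (simp add: field_simps)
        then have "closure (convex hull (f ` (cball (Y t) (L * (s - t) + e / 2) \<inter> K)))
            \<subseteq> closure (convex hull (f ` (cball (Z t) e \<inter> M)))"
          using t by (intro closure_mono hull_mono image_mono) (auto simp: ZY)
        then show "(Z s - Z t) /\<^sub>R (s - t) \<in> closure (convex hull (f ` (cball (Z t) e \<inter> M)))"
          using Y(3) [of t s "e / 2"] t s \<open>0 < e\<close> by (auto simp: ZY)
      qed
    qed simp
    then show ?thesis using D by (auto simp: filippov_on_def)
  qed
  have "negligible (insert 0 {x. \<not> Z differentiable (at x)})"
    using lipschitz_differentiable_AE [of Z L, OF lip] by (simp add: negligible_insert)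
  then have "AE t in lebesgue. t \<notin> insert 0 {x. \<not> Z differentiable (at x)}"
    by (intro AE_not_in) (simp add: negligible_iff_null_sets)
  then have "AE t in lebesgue. t \<in> {0..<T} \<longrightarrow>
       (\<exists>D. (Z has_vector_derivative D) (at t) \<and> D \<in> filippov_on M f (Z t))"
    by (rule AE_mp) (intro AE_I2 impI der; auto)
  then have "inclusion_solution M (filippov_on M f) y0 T Z"
    unfolding inclusion_solution_def using Y(1,2) pos ZY
      lipschitz_imp_absolutely_continuous_on_interval [of L Z, OF _ lip] by auto
  then show ?thesis by blast
qed

end

section \<open>Frobenius norms and oblique projections\<close>

text \<open>As a simp rule it would turn every \<open>transpose A *v x\<close> into \<open>x v* A\<close>.\<close>

declare transpose_matrix_vector [simp del]

lemma norm_transpose: "norm (transpose A) = norm (A :: real ^ 'n ^ 'm)"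
  unfolding norm_eq_sqrt_inner inner_vec_def transpose_def
  by (simp add: sum.swap [of "\<lambda>i j. A $ i $ j * A $ i $ j"])

lemma norm_matrix_sq_columns:
  fixes A :: "real ^ 'n ^ 'm"
  shows "(norm A)\<^sup>2 = (\<Sum>j\<in>UNIV. (norm (column j A))\<^sup>2)"
proof -
  have "(norm (transpose A))\<^sup>2 = (\<Sum>j\<in>UNIV. (norm (transpose A $ j))\<^sup>2)"
    unfolding norm_vec_def [of "transpose A"] L2_set_def by (simp add: sum_nonneg)
  then show ?thesis by (simp only: norm_transpose) (simp add: transpose_def column_def)
qed

lemma column_matrix_mult: "column j (A ** B) = A *v column j (B :: real ^ 'n ^ 'k)"
  by (simp add: vec_eq_iff column_def matrix_matrix_mult_def matrix_vector_mult_def)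

lemma norm_matrix_le_columns:
  fixes A :: "real ^ 'n ^ 'm" and B :: "real ^ 'n ^ 'k"
  assumes "0 \<le> c" "\<And>j. norm (column j A) \<le> c * norm (column j B)"
  shows "norm A \<le> c * norm B"
proof (rule power2_le_imp_le)
  have "(norm A)\<^sup>2 \<le> (\<Sum>j\<in>UNIV. (c * norm (column j B))\<^sup>2)"
    unfolding norm_matrix_sq_columns by (intro sum_mono power_mono assms norm_ge_zero)
  then show "(norm A)\<^sup>2 \<le> (c * norm B)\<^sup>2"
    by (simp add: power_mult_distrib norm_matrix_sq_columns [of B] sum_distrib_left)
qed (use assms in simp)

text \<open>An operator bound acts on each column, and the squared Frobenius norm is the sum of the
  squared column norms. This keeps the constants free of dimension factors.\<close>

lemma norm_mult_left_le:
  fixes Z :: "real ^ 'n ^ 'k"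
  assumes "0 \<le> c" "\<And>x. norm (A *v x) \<le> c * norm x"
  shows "norm (A ** Z) \<le> c * norm Z"
  using assms by (intro norm_matrix_le_columns) (auto simp: column_matrix_mult)

lemma norm_mult_right_le:
  fixes Z :: "real ^ 'n ^ 'm"
  assumes "0 \<le> c" "\<And>x. norm (transpose A *v x) \<le> c * norm x"
  shows "norm (Z ** A) \<le> c * norm Z"
  using norm_mult_left_le [OF assms, of "transpose Z"]
  by (metis norm_transpose matrix_transpose_mul)

lemma norm_matrix_vector_le: "norm (A *v x) \<le> norm A * norm (x :: real ^ 'n)"
proof (rule power2_le_imp_le)
  have "(norm (A *v x))\<^sup>2 = (\<Sum>i\<in>UNIV. (A $ i \<bullet> x)\<^sup>2)"
    unfolding norm_vec_def [of "A *v x"] L2_set_def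
    by (simp add: sum_nonneg matrix_vector_mul_component)
  also have "\<dots> \<le> (\<Sum>i\<in>UNIV. (norm (A $ i) * norm x)\<^sup>2)"
    by (intro sum_mono) (use Cauchy_Schwarz_ineq2 abs_le_square_iff in \<open>fastforce simp: abs_mult\<close>)
  also have "\<dots> = (norm A * norm x)\<^sup>2"
    unfolding norm_vec_def [of A] L2_set_def
    by (simp add: sum_nonneg power_mult_distrib sum_distrib_right)
  finally show "(norm (A *v x))\<^sup>2 \<le> (norm A * norm x)\<^sup>2" .
qed simp

lemma norm_matrix_mult_le: "norm (A ** B) \<le> norm A * norm (B :: real ^ 'n ^ 'k)"
  by (intro norm_mult_left_le norm_matrix_vector_le norm_ge_zero)

lemma matrix_diff_ldistrib: "A ** (B - C) = A ** B - A ** (C :: real ^ 'n ^ 'k)"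
  by (simp add: matrix_matrix_mult_def vec_eq_iff right_diff_distrib sum_subtractf)

text \<open>Krainer's rescaling trick: replacing \<open>x = u + w\<close> by \<open>(\<parallel>w\<parallel>/\<parallel>u\<parallel>) u + (\<parallel>u\<parallel>/\<parallel>w\<parallel>) w\<close> preserves the norm.\<close>

lemma idempotent_complement_norm_le:
  fixes P :: "'a::real_inner \<Rightarrow> 'a"
  assumes "linear P" and idem: "\<And>x. P (P x) = P x"
    and "1 \<le> c" and bound: "\<And>x. norm (P x) \<le> c * norm x"
  shows "norm (x - P x) \<le> c * norm x"
proof -
  define u w where "u = P x" and "w = x - P x"
  have Pu: "P u = u" and Pw: "P w = 0"
    using idem linear_diff [OF \<open>linear P\<close>] by (auto simp: u_def w_def)
  have x: "x = u + w" by (simp add: u_def w_def)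
  show ?thesis
  proof (cases "u = 0 \<or> w = 0")
    case True
    then have "norm (x - P x) \<le> norm x" by (auto simp: u_def w_def)
    also have "\<dots> \<le> c * norm x" using \<open>1 \<le> c\<close> mult_right_mono [of 1 c "norm x"] by simp
    finally show ?thesis .
  next
    case False
    define a where "a = norm w / norm u"
    have a: "0 < a" "a * norm u = norm w" "inverse a * norm w = norm u"
      using False by (auto simp: a_def)
    define x' where "x' = a *\<^sub>R u + inverse a *\<^sub>R w"
    have "(norm x')\<^sup>2 = (norm (a *\<^sub>R u))\<^sup>2 + 2 * (u \<bullet> w) + (norm (inverse a *\<^sub>R w))\<^sup>2"
      using a(1) unfolding x'_def power2_norm_eq_inner
      by (simp add: inner_add inner_commute field_simps)
    also have "\<dots> = (norm w)\<^sup>2 + 2 * (u \<bullet> w) + (norm u)\<^sup>2"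
      using a by simp
    also have "\<dots> = (norm x)\<^sup>2"
      by (simp add: x power2_norm_eq_inner inner_add algebra_simps inner_commute)
    finally have "norm x' = norm x" by simp
    \<comment> \<open>The rescaling gives the range component the length of \<open>w\<close>, so the
      bound for \<open>P\<close> at \<open>x'\<close> is the desired bound for
      \<open>w\<close>.\<close>
    moreover have "P x' = a *\<^sub>R u"
      using Pu Pw \<open>linear P\<close> by (simp add: x'_def linear_add linear_scale)
    ultimately have "norm w \<le> c * norm x" using bound [of x'] a by simp
    then show ?thesis by (simp add: w_def)
  qed
qed

text \<open>If \<open>u = P a\<close> were not orthogonal to the kernel element \<open>w\<close>,
  the shortest vector \<open>u + t *\<^sub>R w\<close> would be shorter than \<open>u\<close>, yet
  \<open>P\<close> maps it to \<open>u\<close>.\<close>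

lemma contractive_idempotent_orthogonal:
  fixes P :: "'a::real_inner \<Rightarrow> 'a"
  assumes "linear P" and idem: "\<And>x. P (P x) = P x" and bound: "\<And>x. norm (P x) \<le> norm x"
  shows "P a \<bullet> (b - P b) = 0"
proof -
  define u w where "u = P a" and "w = b - P b"
  have Pu: "P u = u" and Pw: "P w = 0"
    using idem linear_diff [OF \<open>linear P\<close>] by (auto simp: u_def w_def)
  show ?thesis
  proof (cases "w = 0")
    case False
    define t where "t = - (u \<bullet> w) / (w \<bullet> w)"
    have "P (u + t *\<^sub>R w) = u" using Pu Pw \<open>linear P\<close> by (simp add: linear_add linear_scale)
    then have "norm u \<le> norm (u + t *\<^sub>R w)" using bound [of "u + t *\<^sub>R w"] by simp
    then have "u \<bullet> u \<le> (u + t *\<^sub>R w) \<bullet> (u + t *\<^sub>R w)" by (simp add: norm_le)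
    also have "\<dots> = u \<bullet> u + t * (2 * (u \<bullet> w) + t * (w \<bullet> w))"
      by (simp add: inner_add inner_commute algebra_simps)
    also have "t * (w \<bullet> w) = - (u \<bullet> w)" using False by (simp add: t_def)
    finally have "0 \<le> - ((u \<bullet> w)\<^sup>2 / (w \<bullet> w))" by (simp add: t_def power2_eq_square)
    moreover have "0 < w \<bullet> w" using False by simp
    ultimately have "(u \<bullet> w)\<^sup>2 \<le> 0" by (simp add: divide_le_0_iff)
    then show ?thesis by (simp add: u_def w_def)
  qed (simp add: w_def)
qed

section \<open>Strict bounds for the projected field\<close>

text \<open>Besides the norm of the whole field, the two summands are bounded separately, because
  the Euler step treats them from different sides. The hypothesis on \<open>R\<close> concerns its
  transpose, since \<open>R\<close> multiplies from the right.\<close>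

lemma projected_field_norm_less:
  fixes P :: "real ^ 'm ^ 'm" and R :: "real ^ 'n ^ 'n" and Z :: "real ^ 'n ^ 'm"
  assumes P: "P ** P = P" "\<And>x. norm (P *v x) \<le> Cm * norm x"
    and R: "R ** R = R" "\<And>x. norm (transpose R *v x) \<le> Cn * norm x"
    and C: "1 \<le> Cm" "1 \<le> Cn" and Z: "norm Z \<le> B"
  shows "norm (P ** Z - P ** Z ** R + Z ** R) \<le> (if Cm = 1 then 3 / 2 * Cn * B else Cm * Cn * B + Cn * B)"
    and "norm (P ** Z - P ** Z ** R) \<le> Cm * Cn * B"
    and "norm (Z ** R) \<le> Cn * B"
proof -
  have "0 \<le> B" using Z norm_ge_zero order_trans by blast
  have idR: "transpose R *v (transpose R *v x) = transpose R *v x" for x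
    using R(1) by (metis matrix_transpose_mul matrix_vector_mul_assoc)
  have idP: "P *v (P *v x) = P *v x" for x using P(1) by (metis matrix_vector_mul_assoc)
  have "norm (Z ** R) \<le> Cn * norm Z" using R C by (intro norm_mult_right_le) auto
  also have "\<dots> \<le> Cn * B" using Z C by (intro mult_left_mono) auto
  finally show ZR: "norm (Z ** R) \<le> Cn * B" .
  have "norm (transpose (mat 1 - R) *v x) \<le> Cn * norm x" for x
  proof -
    have "transpose (mat 1 - R) = mat 1 - transpose R"
      by (auto simp: transpose_def mat_def vec_eq_iff)
    then have "transpose (mat 1 - R) *v x = x - transpose R *v x"
      by (simp add: matrix_vector_mult_diff_rdistrib)
    then show ?thesis
      using idempotent_complement_norm_le [OF matrix_vector_mul_linear idR C(2) R(2)] by simp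
  qed
  then have "norm ((P ** Z) ** (mat 1 - R)) \<le> Cn * norm (P ** Z)"
    using C by (intro norm_mult_right_le) auto
  also have "\<dots> \<le> Cn * (Cm * norm Z)"
    using P C by (intro mult_left_mono norm_mult_left_le) auto
  also have "\<dots> \<le> Cn * (Cm * B)" using Z C by (intro mult_left_mono) auto
  finally show X1: "norm (P ** Z - P ** Z ** R) \<le> Cm * Cn * B"
    by (simp add: matrix_diff_ldistrib mult.commute mult.left_commute)
  show "norm (P ** Z - P ** Z ** R + Z ** R) \<le> (if Cm = 1 then 3 / 2 * Cn * B else Cm * Cn * B + Cn * B)"
  proof (cases "Cm = 1")
    case False
    then show ?thesis using norm_triangle_mono [OF X1 ZR] by simp
  next
    case True
    let ?W = "P ** Z - P ** Z ** R + Z ** R"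
    have nP: "norm (P *v x) \<le> norm x" for x using P(2) [of x] True by simp
    have col: "(norm (column j ?W))\<^sup>2 \<le> (norm (column j Z))\<^sup>2 + (norm (column j (Z ** R)))\<^sup>2" for j
    proof -
      let ?z = "column j Z" and ?r = "column j (Z ** R)"
      have "column j ?W = column j (P ** Z) - column j (P ** (Z ** R)) + ?r"
        by (simp add: column_def vec_eq_iff matrix_mul_assoc)
      then have "column j ?W = P *v ?z + (?r - P *v ?r)"
        by (simp add: column_matrix_mult [of j P])
      moreover have "(P *v ?z) \<bullet> (?r - P *v ?r) = 0"
        by (rule contractive_idempotent_orthogonal) (auto simp: idP nP)
      ultimately have "(norm (column j ?W))\<^sup>2 = (norm (P *v ?z))\<^sup>2 + (norm (?r - P *v ?r))\<^sup>2"
        by (simp add: norm_add_Pythagorean orthogonal_def)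
      moreover have "norm (?r - P *v ?r) \<le> 1 * norm ?r"
        by (rule idempotent_complement_norm_le) (auto simp: idP nP)
      ultimately show ?thesis using nP [of ?z] by (simp add: add_mono power_mono)
    qed
    have "(norm ?W)\<^sup>2 \<le> (norm Z)\<^sup>2 + (norm (Z ** R))\<^sup>2"
      unfolding norm_matrix_sq_columns by (subst sum.distrib [symmetric]) (intro sum_mono col)
    also have "\<dots> \<le> (Cn * B)\<^sup>2 + (Cn * B)\<^sup>2"
    proof (intro add_mono power_mono ZR)
      show "norm Z \<le> Cn * B" using Z C \<open>0 \<le> B\<close> mult_right_mono [of 1 Cn B] by simp
    qed auto
    \<comment> \<open>The constant 3/2 stands for any number between sqrt 2 and 2; staying below 2
      is what makes the final bound strict.\<close>
    also have "\<dots> \<le> (3 / 2 * Cn * B)\<^sup>2"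
      by (simp add: power_mult_distrib power_divide)
    finally have "norm ?W \<le> 3 / 2 * Cn * B"
      by (rule power2_le_imp_le) (use C \<open>0 \<le> B\<close> in simp)
    then show ?thesis using True by simp
  qed
qed

section \<open>Isometries, selections and oblique projections\<close>

lemma orthonormal_columns_norm:
  assumes "orthonormal_columns U"
  shows "norm (U *v x) = norm x"
proof -
  have "(U *v x) \<bullet> (U *v x) = x \<bullet> (transpose U *v (U *v x))"
    by (simp add: dot_lmul_matrix [symmetric] inner_commute)
  also have "\<dots> = x \<bullet> x"
    using assms by (simp add: matrix_vector_mul_assoc orthonormal_columns_def)
  finally show ?thesis by (simp add: norm_eq_sqrt_inner)
qed

text \<open>The transposed selection reads off entries of \<open>x\<close>; injectivity of
  \<open>p\<close> ensures that none is counted twice.\<close>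

lemma selection_matrix_transpose_norm_le:
  fixes S :: "real ^ 'r ^ 'm"
  assumes "selection_matrix S"
  shows "norm (transpose S *v x) \<le> norm x"
proof -
  obtain p where p: "inj p" "\<And>j. column j S = axis (p j) 1"
    using assms by (auto simp: selection_matrix_def)
  have comp: "(transpose S *v x) $ j = x $ p j" for j
  proof -
    have "(transpose S *v x) $ j = column j S \<bullet> x"
      by (simp add: matrix_vector_mult_def transpose_def column_def inner_vec_def)
    then show ?thesis by (simp add: p inner_axis')
  qed
  have "(\<Sum>j\<in>UNIV. (x $ p j)\<^sup>2) = (\<Sum>i\<in>range p. (x $ i)\<^sup>2)"
    using p(1) by (simp add: sum.reindex)
  also have "\<dots> \<le> (\<Sum>i\<in>UNIV. (x $ i)\<^sup>2)" by (intro sum_mono2) auto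
  finally show ?thesis by (simp add: norm_vec_def L2_set_def comp del: transpose_matrix_vector)
qed

lemma matrix_inv_invertible:
  fixes A :: "real ^ 'n ^ 'm"
  assumes "invertible A"
  shows "A ** matrix_inv A = mat 1" "matrix_inv A ** A = mat 1"
  using someI_ex [OF assms [unfolded invertible_def]] by (simp_all add: matrix_inv_def)

lemma matrix_inv_transpose:
  fixes A :: "real ^ 'n ^ 'n"
  assumes "invertible A"
  shows "matrix_inv (transpose A) = transpose (matrix_inv A)"
proof -
  have 1: "transpose (matrix_inv A) ** transpose A = mat 1" "transpose A ** transpose (matrix_inv A) = mat 1"
    using matrix_inv_invertible [OF assms] by (metis matrix_transpose_mul transpose_mat)+
  then have "invertible (transpose A)" by (auto simp: invertible_def)
  then have "transpose A ** matrix_inv (transpose A) = mat 1" by (rule matrix_inv_invertible)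
  then have "(transpose (matrix_inv A) ** transpose A) ** matrix_inv (transpose A) = transpose (matrix_inv A)"
    by (simp add: matrix_mul_assoc [symmetric])
  then show ?thesis using 1 by simp
qed

text \<open>Of the three factors, \<open>U\<close> is an isometry, the inverse has norm at most
  \<open>C\<close>, and the transposed selection is a contraction. The product fixes the columns of
  \<open>U\<close>, so it is idempotent, and a fixed unit vector forces 1 <= C.\<close>

lemma oblique_left_properties:
  fixes S :: "real ^ 'r ^ 'm \<Rightarrow> real ^ 'r ^ 'm"
  assumes "deim_rule S C" and U: "orthonormal_columns U"
  shows "oblique_left S U ** oblique_left S U = oblique_left S U"
    and "norm (oblique_left S U *v x) \<le> C * norm x"
    and "1 \<le> C"
proof -
  define A where "A = transpose (S U) ** U"
  have S: "selection_matrix (S U)" "invertible A" "spectral_norm (matrix_inv A) \<le> C"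
    using assms by (auto simp: deim_rule_def A_def)
  let ?P = "oblique_left S U"
  have P: "?P = U ** matrix_inv A ** transpose (S U)" by (simp add: oblique_left_def A_def)
  have inv: "matrix_inv A ** A = mat 1" using S(2) by (rule matrix_inv_invertible)
  have PU: "?P ** U = U"
    unfolding P using inv by (simp add: A_def matrix_mul_assoc [symmetric])
  show "?P ** ?P = ?P" using PU by (simp add: P matrix_mul_assoc)
  show le: "norm (?P *v x) \<le> C * norm x" for x
  proof -
    have "norm (?P *v x) = norm (matrix_inv A *v (transpose (S U) *v x))"
      unfolding P using orthonormal_columns_norm [OF U]
      by (simp add: matrix_vector_mul_assoc [symmetric])
    also have "\<dots> \<le> spectral_norm (matrix_inv A) * norm (transpose (S U) *v x)"
      unfolding spectral_norm_def by (rule onorm) simp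
    also have "\<dots> \<le> C * norm x"
      using S(3) selection_matrix_transpose_norm_le [OF S(1)] onorm_pos_le [of "(*v) (matrix_inv A)"]
      by (intro mult_mono) (auto simp: spectral_norm_def)
    finally show ?thesis .
  qed
  have "norm (U *v axis i 1) = 1" for i :: 'r
    using orthonormal_columns_norm [OF U] by simp
  moreover have "?P *v (U *v axis i 1) = U *v axis i 1" for i
    using PU by (simp add: matrix_vector_mul_assoc)
  ultimately show "1 \<le> C" using le [of "U *v axis undefined 1"] by simp
qed

text \<open>Lets the facts about the left projection serve for the right one.\<close>

lemma oblique_right_eq_transpose:
  assumes "deim_rule S C" "orthonormal_columns V"
  shows "oblique_right S V = transpose (oblique_left S V)"
proof -
  have "invertible (transpose (S V) ** V)" using assms by (auto simp: deim_rule_def)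
  then have "matrix_inv (transpose V ** S V) = transpose (matrix_inv (transpose (S V) ** V))"
    by (metis matrix_inv_transpose matrix_transpose_mul transpose_transpose)
  then show ?thesis
    by (simp add: oblique_left_def oblique_right_def matrix_transpose_mul matrix_mul_assoc)
qed

section \<open>Singular values and rank\<close>

lemma inner_matrix_vector: "(A *v x) \<bullet> y = x \<bullet> (transpose A *v (y :: real ^ 'm))"
  by (simp add: dot_lmul_matrix [symmetric] transpose_matrix_vector inner_commute)

lemma subspace_range_matrix: "subspace (range ((*v) (A :: real ^ 'n ^ 'm)))"
  by (intro linear_subspace_image matrix_vector_mul_linear subspace_UNIV)

lemma dim_range_transpose: "dim (range ((*v) (transpose A))) = rank (A :: real ^ 'n ^ 'm)"
  by (metis rank_dim_range rank_transpose)

lemma row_space_kernel: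
  assumes "v \<in> range ((*v) (transpose A))" "A *v v = 0"
  shows "v = (0 :: real ^ 'n)"
proof -
  obtain y where "v = transpose A *v y" using assms by auto
  then have "v \<bullet> v = (A *v v) \<bullet> y" by (simp add: inner_matrix_vector)
  then show ?thesis using assms by simp
qed

text \<open>The component of a preimage orthogonal to the row space is killed by \<open>A\<close>
  and can be discarded.\<close>

lemma range_eq_image_row_space:
  fixes A :: "real ^ 'n ^ 'm"
  assumes "u \<in> range ((*v) A)"
  obtains w where "w \<in> range ((*v) (transpose A))" "A *v w = u"
proof -
  obtain x where x: "u = A *v x" using assms by auto
  let ?W = "range ((*v) (transpose A))"
  obtain w z where wz: "w \<in> span ?W" "\<And>w. w \<in> span ?W \<Longrightarrow> orthogonal z w" "x = w + z"
    using orthogonal_subspace_decomp_exists by metis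
  have "(A *v z) \<bullet> (A *v z) = z \<bullet> (transpose A *v (A *v z))" by (rule inner_matrix_vector)
  also have "\<dots> = 0" using wz(2) by (simp add: orthogonal_def span_base)
  finally have "A *v w = u" using wz x by (simp add: matrix_vector_right_distrib)
  moreover have "w \<in> ?W" using wz(1) span_eq_iff subspace_range_matrix by metis
  ultimately show thesis using that by blast
qed

text \<open>Eigenvectors of the symmetric matrix \<open>transpose A ** A\<close> for distinct
  eigenvalues are orthogonal, hence independent. Finiteness is what gives the \<open>Min\<close> in
  the definition of the smallest nonzero singular value its meaning.\<close>

lemma finite_singular_values: "finite {\<sigma>. singular_value (A :: real ^ 'n ^ 'm) \<sigma>}"
proof -
  define N where "N = transpose A ** A"
  have sym: "(N *v x) \<bullet> y = x \<bullet> (N *v y)" for x y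
    by (simp add: N_def inner_matrix_vector matrix_transpose_mul)
  define S where "S = {\<sigma>. singular_value A \<sigma>}"
  have "\<exists>v. v \<noteq> 0 \<and> N *v v = \<sigma>\<^sup>2 *\<^sub>R v" if "\<sigma> \<in> S" for \<sigma>
    using that by (auto simp: S_def singular_value_def N_def)
  then obtain e where e: "\<And>\<sigma>. \<sigma> \<in> S \<Longrightarrow> e \<sigma> \<noteq> 0" "\<And>\<sigma>. \<sigma> \<in> S \<Longrightarrow> N *v e \<sigma> = \<sigma>\<^sup>2 *\<^sub>R e \<sigma>"
    by metis
  have orth: "e \<sigma> \<bullet> e \<tau> = 0" if "\<sigma> \<in> S" "\<tau> \<in> S" "\<sigma> \<noteq> \<tau>" for \<sigma> \<tau>
  proof -
    have "\<sigma>\<^sup>2 * (e \<sigma> \<bullet> e \<tau>) = \<tau>\<^sup>2 * (e \<sigma> \<bullet> e \<tau>)"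
      using sym [of "e \<sigma>" "e \<tau>"] e that by simp
    moreover have "\<sigma>\<^sup>2 \<noteq> \<tau>\<^sup>2"
      using that by (auto simp: S_def singular_value_def power2_eq_iff_nonneg)
    ultimately show ?thesis by simp
  qed
  have "inj_on e S"
  proof (rule inj_onI, rule ccontr)
    fix \<sigma> \<tau> assume "\<sigma> \<in> S" "\<tau> \<in> S" "e \<sigma> = e \<tau>" "\<sigma> \<noteq> \<tau>"
    then show False using orth [of \<sigma> \<tau>] e(1) by simp
  qed
  moreover have "pairwise orthogonal (e ` S)"
    using orth by (auto simp: pairwise_def orthogonal_def)
  then have "independent (e ` S)"
    using e(1) by (intro pairwise_orthogonal_independent) force+
  then have "finite (e ` S)" by (rule independent_imp_finite)
  ultimately show ?thesis using finite_imageD S_def by blast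
qed

text \<open>The norm of \<open>A *v x\<close> attains a minimum \<open>s\<close> over the unit
  vectors of the row space. The minimiser is an eigenvector of \<open>transpose A ** A\<close>, so
  \<open>s\<close> is a nonzero singular value and the \<open>Min\<close> is at most
  \<open>s\<close>.\<close>

lemma smallest_singular_value_bound:
  fixes A :: "real ^ 'n ^ 'm"
  assumes "rank A > 0"
  shows "0 < smallest_nonzero_singular_value A"
    and "v \<in> range ((*v) (transpose A)) \<Longrightarrow> smallest_nonzero_singular_value A * norm v \<le> norm (A *v v)"
proof -
  define W where "W = range ((*v) (transpose A))"
  have subW: "subspace W" unfolding W_def by (rule subspace_range_matrix)
  let ?S = "{\<sigma>. singular_value A \<sigma> \<and> \<sigma> \<noteq> 0}"
  have fin: "finite ?S" using finite_singular_values [of A] by (rule rev_finite_subset) auto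
  have "dim W > 0" using assms dim_range_transpose [of A] by (simp add: W_def)
  then obtain w where w: "w \<in> W" "w \<noteq> 0" by (metis dim_eq_0 less_irrefl singletonI subsetI)
  let ?D = "W \<inter> sphere 0 1"
  have "compact ?D" by (intro closed_Int_compact closed_subspace subW) auto
  moreover have "w /\<^sub>R norm w \<in> ?D" using w subW by (auto simp: subspace_scale)
  ultimately obtain x where x: "x \<in> ?D" "\<And>y. y \<in> ?D \<Longrightarrow> norm (A *v x) \<le> norm (A *v y)"
    using continuous_attains_inf [of ?D "\<lambda>x. norm (A *v x)"]
    by (metis empty_iff continuous_on_norm linear_continuous_on matrix_vector_mul_bounded_linear)
  define s where "s = norm (A *v x)"
  have nx: "norm x = 1" "x \<in> W" using x by auto
  have le: "s * norm y \<le> norm (A *v y)" if "y \<in> W" for y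
  proof (cases "y = 0")
    case False
    then have "y /\<^sub>R norm y \<in> ?D" using that subW by (auto simp: subspace_scale)
    from x(2) [OF this] show ?thesis
      using False by (simp add: s_def matrix_vector_mult_scaleR field_simps)
  qed simp
  have "s > 0" using row_space_kernel [of x A] nx by (auto simp: s_def W_def)
  \<comment> \<open>The defect in the eigenvector equation lies in the row space, so it is an
    admissible direction of variation. Minimality makes a quadratic in \<open>t\<close> nonnegative,
    and its linear coefficient \<open>2 * (z \<bullet> z)\<close> must then vanish.\<close>
  define z where "z = transpose A *v (A *v x) - s\<^sup>2 *\<^sub>R x"
  have zW: "z \<in> W"
    unfolding z_def using nx subW by (intro subspace_diff subspace_scale) (auto simp: W_def)
  have xx: "x \<bullet> x = 1" using nx by (simp add: norm_eq_1)
  have "0 \<le> 2 * t * (z \<bullet> z) + t\<^sup>2 * ((A *v z) \<bullet> (A *v z) - s\<^sup>2 * (z \<bullet> z))" for t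
  proof -
    have "x + t *\<^sub>R z \<in> W" using nx zW subW by (intro subspace_add subspace_scale)
    then have "(s * norm (x + t *\<^sub>R z))\<^sup>2 \<le> (norm (A *v (x + t *\<^sub>R z)))\<^sup>2"
      using \<open>s > 0\<close> by (intro power_mono le) auto
    then have "s\<^sup>2 * ((x + t *\<^sub>R z) \<bullet> (x + t *\<^sub>R z)) \<le> (A *v x + t *\<^sub>R (A *v z)) \<bullet> (A *v x + t *\<^sub>R (A *v z))"
      by (simp add: power_mult_distrib power2_norm_eq_inner matrix_vector_right_distrib matrix_vector_mult_scaleR)
    moreover have "(A *v x) \<bullet> (A *v x) = s\<^sup>2" by (simp add: s_def power2_norm_eq_inner)
    moreover have "(A *v x) \<bullet> (A *v z) = z \<bullet> z + s\<^sup>2 * (x \<bullet> z)"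
      by (simp add: inner_commute [of "A *v x"] inner_matrix_vector z_def inner_diff inner_commute algebra_simps)
    ultimately show ?thesis
      using xx by (simp add: inner_add inner_commute algebra_simps power2_eq_square)
  qed note quad = this
  have "z \<bullet> z = 0"
  proof (rule ccontr)
    assume "z \<bullet> z \<noteq> 0"
    then have "0 < z \<bullet> z" by simp
    define k where "k = \<bar>(A *v z) \<bullet> (A *v z) - s\<^sup>2 * (z \<bullet> z)\<bar> + 1"
    \<comment> \<open>The positive number \<open>k\<close> dominates the quadratic coefficient, and
      this \<open>t\<close> minimises the majorant
      \<open>2 * t * (z \<bullet> z) + t\<^sup>2 * k\<close>.\<close>
    define t where "t = - (z \<bullet> z) / k"
    have "0 < k" by (simp add: k_def)
    have "2 * t * (z \<bullet> z) + t\<^sup>2 * ((A *v z) \<bullet> (A *v z) - s\<^sup>2 * (z \<bullet> z)) \<le> 2 * t * (z \<bullet> z) + t\<^sup>2 * k"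
      by (intro add_left_mono mult_left_mono) (auto simp: k_def)
    also have "\<dots> = - ((z \<bullet> z)\<^sup>2 / k)"
      using \<open>0 < k\<close> by (simp add: t_def power2_eq_square field_simps)
    also have "\<dots> < 0" using \<open>0 < k\<close> \<open>0 < z \<bullet> z\<close> by simp
    finally show False using quad [of t] by simp
  qed
  then have "(transpose A ** A) *v x = s\<^sup>2 *\<^sub>R x" by (simp add: z_def matrix_vector_mul_assoc)
  then have sS: "s \<in> ?S" using \<open>s > 0\<close> nx by (auto simp: singular_value_def intro!: exI [of _ x])
  have "smallest_nonzero_singular_value A \<in> ?S"
    unfolding smallest_nonzero_singular_value_def using fin sS by (intro Min_in) auto
  then show "0 < smallest_nonzero_singular_value A"
    by (auto simp: singular_value_def)
  have "smallest_nonzero_singular_value A \<le> s"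
    unfolding smallest_nonzero_singular_value_def using fin sS by (intro Min_le)
  then show "smallest_nonzero_singular_value A * norm v \<le> norm (A *v v)" if "v \<in> range ((*v) (transpose A))"
    using le [of v] that mult_right_mono [of "smallest_nonzero_singular_value A" s "norm v"]
    by (simp add: W_def)
qed

text \<open>Write u = A w with w in the row space. Then |u|^2 is the inner product of w with the
  transpose of A applied to u; Cauchy-Schwarz and \<sigma> |w| <= |u| let one factor |u| cancel. The
  singular values of \<open>A\<close> and of its transpose need not be compared.\<close>

lemma smallest_singular_value_transpose_bound:
  fixes A :: "real ^ 'n ^ 'm"
  assumes "rank A > 0" "u \<in> range ((*v) A)"
  shows "smallest_nonzero_singular_value A * norm u \<le> norm (transpose A *v u)"
proof (cases "u = 0")
  case False
  let ?s = "smallest_nonzero_singular_value A"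
  obtain w where w: "w \<in> range ((*v) (transpose A))" "A *v w = u"
    using range_eq_image_row_space [OF assms(2)] by blast
  have "norm u * norm u = w \<bullet> (transpose A *v u)"
    using w inner_matrix_vector [of A w u]
    by (simp add: power2_norm_eq_inner flip: power2_eq_square)
  also have "\<dots> \<le> norm w * norm (transpose A *v u)" by (rule norm_cauchy_schwarz)
  finally have "?s * (norm u * norm u) \<le> (?s * norm w) * norm (transpose A *v u)"
    using smallest_singular_value_bound(1) [OF assms(1)] by simp
  also have "\<dots> \<le> norm u * norm (transpose A *v u)"
    using smallest_singular_value_bound(2) [OF assms(1) w(1)] w(2) by (intro mult_right_mono) auto
  finally show ?thesis using False by simp
qed simp

section \<open>Stability of the rank under perturbation\<close>

lemma bounded_below_perturb:
  fixes A B :: "real ^ 'n ^ 'm"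
  assumes "c * norm w \<le> norm (A *v w)" "norm (B - A) \<le> \<rho>"
  shows "(c - \<rho>) * norm w \<le> norm (B *v w)"
proof -
  have "norm (A *v w) \<le> norm (B *v w) + norm ((B - A) *v w)"
    using norm_triangle_ineq4 [of "B *v w" "(B - A) *v w"]
    by (simp add: matrix_vector_mult_diff_rdistrib)
  moreover have "norm ((B - A) *v w) \<le> \<rho> * norm w"
    using norm_matrix_vector_le [of "B - A" w] mult_right_mono [OF assms(2), of "norm w"] by simp
  ultimately show ?thesis using assms(1) by (simp add: left_diff_distrib)
qed

lemma bounded_below_dim_image:
  fixes A :: "real ^ 'n ^ 'm"
  assumes "subspace W" "0 < c" "\<And>w. w \<in> W \<Longrightarrow> c * norm w \<le> norm (A *v w)"
  shows "dim ((*v) A ` W) = dim W"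
proof (rule dim_image_eq)
  show "inj_on ((*v) A) (span W)"
  proof (rule inj_onI)
    fix x y assume xy: "x \<in> span W" "y \<in> span W" "A *v x = A *v y"
    then have "x - y \<in> W" using assms(1) by (metis span_eq_iff subspace_diff)
    then have "c * norm (x - y) \<le> 0" using assms(3) xy by (force simp: matrix_vector_mult_diff_distrib)
    then show "x = y" using \<open>0 < c\<close> by (simp add: mult_le_0_iff)
  qed
qed simp

lemma bounded_below_dim_le_rank:
  fixes A :: "real ^ 'n ^ 'm"
  assumes "subspace W" "0 < c" "\<And>w. w \<in> W \<Longrightarrow> c * norm w \<le> norm (A *v w)"
  shows "dim W \<le> rank A"
  using bounded_below_dim_image [OF assms] dim_subset [of "(*v) A ` W" "range ((*v) A)"]
  by (simp add: rank_dim_range image_mono)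

text \<open>The rank is lower semicontinuous: on its row space \<open>A\<close> is injective, hence
  bounded below by some \<open>e\<close>, and a perturbation smaller than \<open>e\<close> leaves
  the map injective there.\<close>

lemma closed_rank_le: "closed {X :: real ^ 'n ^ 'm. rank X \<le> r}"
proof -
  have "open {X :: real ^ 'n ^ 'm. r < rank X}"
    unfolding open_contains_ball
  proof
    fix A :: "real ^ 'n ^ 'm" assume "A \<in> {X. r < rank X}"
    let ?W = "range ((*v) (transpose A))"
    obtain e where e: "0 < e" "\<And>x. x \<in> ?W \<Longrightarrow> e * norm x \<le> norm (A *v x)"
      using injective_imp_isometric [of ?W "(*v) A"] row_space_kernel [of _ A]
        closed_subspace [OF subspace_range_matrix] subspace_range_matrix
      by (metis matrix_vector_mul_bounded_linear)
    have "B \<in> {X. r < rank X}" if "B \<in> ball A e" for B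
    proof -
      define \<rho> where "\<rho> = norm (B - A)"
      have "\<rho> < e" using that by (simp add: \<rho>_def dist_norm norm_minus_commute)
      have "dim ?W \<le> rank B"
        by (rule bounded_below_dim_le_rank [where c = "e - \<rho>"])
          (use \<open>\<rho> < e\<close> e bounded_below_perturb [where \<rho> = \<rho> and c = e and A = A] subspace_range_matrix in \<open>auto simp: \<rho>_def\<close>)
      then show ?thesis using \<open>A \<in> _\<close> by (simp add: dim_range_transpose)
    qed
    then show "\<exists>e>0. ball A e \<subseteq> {X. r < rank X}" using e(1) by blast
  qed
  moreover have "{X :: real ^ 'n ^ 'm. rank X \<le> r} = - {X. r < rank X}" by auto
  ultimately show ?thesis by (simp add: closed_def)
qed

text \<open>By the dimension count \<open>A\<close> maps \<open>W\<close> onto its whole range, so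
  every column has a preimage in \<open>W\<close> of controlled length. \<open>W\<close> need not be
  the row space of \<open>A\<close>: in the application it belongs to the centre \<open>Y0\<close>,
  which gives one constant \<open>c\<close> for the whole ball.\<close>

lemma matrix_preimage_bounded:
  fixes A :: "real ^ 'n ^ 'm" and X :: "real ^ 'k ^ 'm"
  assumes W: "subspace W" "0 < c" "\<And>w. w \<in> W \<Longrightarrow> c * norm w \<le> norm (A *v w)" "rank A \<le> dim W"
    and X: "\<And>j. column j X \<in> range ((*v) A)"
  obtains Q where "A ** Q = X" "norm Q \<le> norm X / c"
proof -
  have "(*v) A ` W = range ((*v) A)"
  proof (rule subspace_dim_equal)
    show "dim (range ((*v) A)) \<le> dim ((*v) A ` W)"
      using W bounded_below_dim_image [OF W(1-3)] by (simp add: rank_dim_range)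
  qed (auto intro: linear_subspace_image W subspace_range_matrix)
  then have "\<exists>w. w \<in> W \<and> A *v w = column j X" for j using X [of j] by (metis imageE)
  then obtain q where q: "\<And>j. q j \<in> W" "\<And>j. A *v q j = column j X" by metis
  define Q where "Q = (\<chi> i j. q j $ i)"
  have col: "column j Q = q j" for j by (simp add: Q_def column_def vec_eq_iff)
  have "column j (A ** Q) = column j X" for j by (simp add: column_matrix_mult col q)
  then have "A ** Q = X" by (simp add: column_def vec_eq_iff)
  moreover have "norm Q \<le> (1 / c) * norm X"
    using W(2,3) q by (intro norm_matrix_le_columns) (auto simp: col field_simps simp flip: q(2))
  ultimately show thesis using that by simp
qed

lemma matrix_add_rdistrib: "(A + B) ** C = A ** C + B ** (C :: real ^ 'n ^ 'k)"
  by (simp add: matrix_matrix_mult_def vec_eq_iff distrib_right sum.distrib)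

text \<open>
  A tangent vector at \<open>Y\<close> is \<open>P Y + Y Q\<close>; then \<open>(I + h P) Y (I + h Q)\<close> follows it up to second
  order without raising the rank.
\<close>

lemma rank_preserving_step:
  fixes Y X1 X2 :: "real ^ 'n ^ 'm"
  assumes W1: "subspace W1" "\<And>w. w \<in> W1 \<Longrightarrow> c * norm w \<le> norm (Y *v w)" "rank Y \<le> dim W1"
    and W2: "subspace W2" "\<And>w. w \<in> W2 \<Longrightarrow> c * norm w \<le> norm (transpose Y *v w)" "rank Y \<le> dim W2"
    and "0 < c"
    and X1: "\<And>j. column j X1 \<in> range ((*v) Y)" "norm X1 \<le> b1"
    and X2: "\<And>j. column j (transpose X2) \<in> range ((*v) (transpose Y))" "norm X2 \<le> b2"
  obtains Y' where "rank Y' \<le> rank Y" "norm (Y' - Y - h *\<^sub>R (X1 + X2)) \<le> (b2 / c * b1) * h\<^sup>2"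
proof -
  obtain Q where Q: "Y ** Q = X1"
    using matrix_preimage_bounded [OF W1(1) \<open>0 < c\<close> W1(2,3) X1(1)] by blast
  obtain P' where P': "transpose Y ** P' = transpose X2" "norm P' \<le> norm (transpose X2) / c"
    using matrix_preimage_bounded [OF W2(1) \<open>0 < c\<close> W2(2) _ X2(1)] W2(3) by (metis rank_transpose)
  define P where "P = transpose P'"
  have P: "P ** Y = X2" "norm P \<le> norm X2 / c"
    using P' by (metis P_def matrix_transpose_mul transpose_transpose) (use P' in \<open>simp add: P_def norm_transpose\<close>)
  \<comment> \<open>The product contributes the cross term h^2 P Y Q, and P Y Q = P X1; the error is
    therefore controlled by the norms of \<open>P\<close> and \<open>X1\<close> alone.\<close>
  have PX: "X2 ** Q = P ** X1" using P(1) Q by (metis matrix_mul_assoc)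
  define Y' where "Y' = (mat 1 + h *\<^sub>R P) ** Y ** (mat 1 + h *\<^sub>R Q)"
  have "rank Y' \<le> rank Y"
    unfolding Y'_def by (rule order_trans [OF rank_mul_le_left rank_mul_le_right])
  moreover have "Y' - Y - h *\<^sub>R (X1 + X2) = h\<^sup>2 *\<^sub>R (P ** X1)"
    unfolding Y'_def using P(1) Q PX
    by (simp add: matrix_add_rdistrib matrix_add_ldistrib scalar_matrix_assoc [symmetric] matrix_scalar_ac
        power2_eq_square scaleR_add_right flip: matrix_mul_assoc)
  moreover have "norm (P ** X1) \<le> b2 / c * b1"
  proof -
    have "norm (P ** X1) \<le> norm P * norm X1" by (rule norm_matrix_mult_le)
    also have "\<dots> \<le> b2 / c * b1"
    proof (rule mult_mono)
      show "norm P \<le> b2 / c" using P(2) X2(2) \<open>0 < c\<close> by (meson divide_right_mono less_imp_le order_trans)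
    qed (use X1(2) \<open>0 < c\<close> order_trans [OF norm_ge_zero X2(2)] in auto)
    finally show ?thesis .
  qed
  then have "norm (h\<^sup>2 *\<^sub>R (P ** X1)) \<le> (b2 / c * b1) * h\<^sup>2"
    using mult_left_mono [of "norm (P ** X1)" "b2 / c * b1" "h\<^sup>2"] by (simp add: mult.commute)
  ultimately show thesis by (intro that [of Y']) simp_all
qed

section \<open>The DEIM field\<close>

text \<open>The range of \<open>Y\<close> lies in that of \<open>U\<close>, whose dimension is at
  most \<open>CARD('r)\<close>; the rank of \<open>Y\<close> leaves no room between them, so
  invertibility of \<Sigma> is never assumed.\<close>

lemma factorization_range:
  fixes U :: "real ^ 'r ^ 'm" and V :: "real ^ 'r ^ 'n"
  assumes "Y = U ** \<Sigma> ** transpose V" "rank Y = CARD('r)"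
  shows "range ((*v) U) = range ((*v) Y)" "range ((*v) V) = range ((*v) (transpose Y))"
proof -
  have *: "range ((*v) A) = range ((*v) X)"
    if "X = A ** B" "rank X = CARD('r)" for X :: "real ^ 'k ^ 'l" and A :: "real ^ 'r ^ 'l" and B
  proof (rule subspace_dim_equal [symmetric])
    show "dim (range ((*v) A)) \<le> dim (range ((*v) X))"
      using that rank_bound [of A] by (simp flip: rank_dim_range)
    show "range ((*v) X) \<subseteq> range ((*v) A)"
      using that by (auto simp flip: matrix_vector_mul_assoc)
  qed (rule subspace_range_matrix)+
  show "range ((*v) U) = range ((*v) Y)"
    using assms by (intro * [of _ _ "\<Sigma> ** transpose V"]) (simp_all add: matrix_mul_assoc)
  have "transpose Y = V ** (transpose \<Sigma> ** transpose U)"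
    by (simp add: assms(1) matrix_transpose_mul matrix_mul_assoc)
  then show "range ((*v) V) = range ((*v) (transpose Y))"
    by (rule * ) (simp add: rank_transpose assms(2))
qed

lemma oblique_left_range: "column j (oblique_left S U ** Z) \<in> range ((*v) U)"
  by (simp add: column_matrix_mult oblique_left_def flip: matrix_vector_mul_assoc)

text \<open>Well-definedness turns the \<open>THE\<close> value into the projection for some
  factorization, and its two summands fit the column space and the row space of \<open>Y\<close>, as
  the rank-preserving step requires. The bounds 1 <= Cm and 1 <= Cn come from here because the
  factorization supplies matrices with orthonormal columns on which the rules can be
  evaluated.\<close>

lemma deim_field_decomposition:
  fixes SU :: "real ^ 'r ^ 'm \<Rightarrow> real ^ 'r ^ 'm" and SV :: "real ^ 'r ^ 'n \<Rightarrow> real ^ 'r ^ 'n"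
    and F :: "real ^ 'n ^ 'm \<Rightarrow> real ^ 'n ^ 'm"
  assumes S: "deim_rule SU Cm" "deim_rule SV Cn"
    and F: "norm (F Y) \<le> B" "deim_field_well_defined SU SV F" and Y: "Y \<in> fixed_rank CARD('r)"
  obtains X1 X2 where "deim_field SU SV F Y = X1 + X2"
    "\<And>j. column j X1 \<in> range ((*v) Y)" "norm X1 \<le> Cm * Cn * B"
    "\<And>j. column j (transpose X2) \<in> range ((*v) (transpose Y))" "norm X2 \<le> Cn * B"
    "norm (deim_field SU SV F Y) \<le> (if Cm = 1 then 3 / 2 * Cn * B else Cm * Cn * B + Cn * B)"
    "1 \<le> Cm" "1 \<le> Cn"
proof -
  have "deim_field_value SU SV F Y (deim_field SU SV F Y)"
    unfolding deim_field_def
    by (rule theI') (use F(2) Y in \<open>simp add: deim_field_well_defined_def\<close>)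
  then obtain U \<Sigma> V where UV: "orthonormal_columns U" "orthonormal_columns V" "Y = U ** \<Sigma> ** transpose V"
      "deim_field SU SV F Y = oblique_tangent_projection SU SV U V (F Y)"
    by (auto simp: deim_field_value_def is_factorization_def)
  have rk: "rank Y = CARD('r)" using Y by (simp add: fixed_rank_def)
  define P R Z where "P = oblique_left SU U" and "R = oblique_right SV V" and "Z = F Y"
  have P: "P ** P = P" "\<And>x. norm (P *v x) \<le> Cm * norm x" "1 \<le> Cm"
    unfolding P_def by (rule oblique_left_properties [OF S(1) UV(1)])+
  have RT: "transpose R = oblique_left SV V"
    unfolding R_def oblique_right_eq_transpose [OF S(2) UV(2)] by simp
  have R: "R ** R = R" "\<And>x. norm (transpose R *v x) \<le> Cn * norm x" "1 \<le> Cn"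
    using oblique_left_properties [OF S(2) UV(2)] RT
    by (metis matrix_transpose_mul transpose_transpose, auto)
  note bounds = projected_field_norm_less [OF P(1,2) R(1,2) P(3) R(3) F(1) [folded Z_def]]
  have eq: "deim_field SU SV F Y = P ** Z - P ** Z ** R + Z ** R"
    unfolding UV(4) oblique_tangent_projection_def P_def R_def Z_def ..
  show thesis
  proof (rule that [of "P ** Z - P ** Z ** R" "Z ** R"])
    show "column j (P ** Z - P ** Z ** R) \<in> range ((*v) Y)" for j
    proof -
      have "P ** Z - P ** Z ** R = P ** (Z - Z ** R)"
        by (simp add: matrix_diff_ldistrib matrix_mul_assoc)
      then show ?thesis
        using oblique_left_range [of j SU U] factorization_range(1) [OF UV(3) rk]
        by (simp add: P_def)
    qed
    show "column j (transpose (Z ** R)) \<in> range ((*v) (transpose Y))" for j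
      using oblique_left_range [of j SV V] factorization_range(2) [OF UV(3) rk]
      by (simp add: matrix_transpose_mul RT)
  qed (use eq bounds P(3) R(3) in simp_all)
qed

theorem theorem8:
  fixes F :: "real ^ 'n ^ 'm \<Rightarrow> real ^ 'n ^ 'm"
    and SU :: "real ^ 'r ^ 'm \<Rightarrow> real ^ 'r ^ 'm"
    and SV :: "real ^ 'r ^ 'n \<Rightarrow> real ^ 'r ^ 'n"
    and Cm Cn B t1 :: real
    and Y0 :: "real ^ 'n ^ 'm"
  assumes "deim_rule SU Cm"
    and "deim_rule SV Cn"
    and "B > 0"
    and "\<forall>X. norm (F X) \<le> B"
    and "deim_field_well_defined SU SV F"
    and "Y0 \<in> fixed_rank CARD('r)"
    and "t1 = smallest_nonzero_singular_value Y0 / (2 * Cm * Cn * B)"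
  shows "\<exists>tmax Y. tmax > t1 \<and>
    inclusion_solution (fixed_rank CARD('r))
      (filippov_on (fixed_rank CARD('r)) (deim_field SU SV F)) Y0 tmax Y"
proof -
  let ?M = "fixed_rank CARD('r) :: (real ^ 'n ^ 'm) set"
  let ?f = "deim_field SU SV F"
  define \<sigma> where "\<sigma> = smallest_nonzero_singular_value Y0"
  define L where "L = (if Cm = 1 then 3 / 2 * Cn * B else Cm * Cn * B + Cn * B)"
  have dec: "\<exists>X1 X2. ?f Y = X1 + X2 \<and> (\<forall>j. column j X1 \<in> range ((*v) Y)) \<and> norm X1 \<le> Cm * Cn * B \<and>
      (\<forall>j. column j (transpose X2) \<in> range ((*v) (transpose Y))) \<and> norm X2 \<le> Cn * B \<and>
      norm (?f Y) \<le> L \<and> 1 \<le> Cm \<and> 1 \<le> Cn" if "Y \<in> ?M" for Y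
    unfolding L_def
    using deim_field_decomposition [OF assms(1,2) assms(4) [rule_format] assms(5) that] by metis
  have C: "1 \<le> Cm" "1 \<le> Cn" using dec [OF assms(6)] by auto
  have L: "0 < L" "L < 2 * Cm * Cn * B"
    using C \<open>0 < B\<close> by (auto simp: L_def add_pos_pos)
  have rk0: "rank Y0 = CARD('r)" using assms(6) by (simp add: fixed_rank_def)
  then have "0 < rank Y0" by simp
  note s = smallest_singular_value_bound [OF this, folded \<sigma>_def]
    smallest_singular_value_transpose_bound [OF this, folded \<sigma>_def]
  have "t1 < \<sigma> / L"
    using s(1) L C \<open>0 < B\<close> unfolding assms(7) \<sigma>_def [symmetric]
    by (intro divide_strict_left_mono mult_pos_pos) auto
  moreover have "0 < t1"
    using s(1) C \<open>0 < B\<close> unfolding assms(7) \<sigma>_def [symmetric] by (intro divide_pos_pos mult_pos_pos) auto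
  \<comment> \<open>The strictness of \<open>L < 2 * Cm * Cn * B\<close> is spent here: it leaves
    room for an end time beyond \<open>t1\<close>, and then for a radius between
    \<open>L * T\<close> and \<sigma>.\<close>
  ultimately obtain T where T: "t1 < T" "0 < T" "T < \<sigma> / L"
    using dense [of t1 "\<sigma> / L"] by (metis less_trans)
  then have "L * T < \<sigma>" using L by (simp add: field_simps)
  then obtain \<rho> where \<rho>: "L * T < \<rho>" "\<rho> < \<sigma>" using dense by blast
  \<comment> \<open>Both subspaces belong to \<open>Y0\<close> and not to the varying
    \<open>Y\<close>, so the lower bound \<sigma> - \<rho> holds throughout the ball.\<close>
  let ?W1 = "range ((*v) (transpose Y0))" and ?W2 = "range ((*v) Y0)"
  have near: "(\<sigma> - \<rho>) * norm w \<le> norm (Y *v w)" if "Y \<in> cball Y0 \<rho>" "w \<in> ?W1" for Y w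
    using that by (intro bounded_below_perturb [OF s(2)]) (auto simp: dist_norm norm_minus_commute)
  have near': "(\<sigma> - \<rho>) * norm w \<le> norm (transpose Y *v w)" if "Y \<in> cball Y0 \<rho>" "w \<in> ?W2" for Y w
  proof (intro bounded_below_perturb [OF s(3)])
    have "transpose Y - transpose Y0 = transpose (Y - Y0)"
      by (simp add: transpose_def vec_eq_iff)
    then show "norm (transpose Y - transpose Y0) \<le> \<rho>"
      using that by (simp add: norm_transpose dist_norm norm_minus_commute)
  qed (use that in auto)
  have rk: "Y \<in> ?M \<longleftrightarrow> rank Y \<le> CARD('r)" if "Y \<in> cball Y0 \<rho>" for Y
  proof -
    have "dim ?W1 \<le> rank Y"
      by (rule bounded_below_dim_le_rank [OF subspace_range_matrix _ near [OF that]]) (use \<rho> in auto)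
    then show ?thesis by (auto simp: dim_range_transpose rk0 fixed_rank_def)
  qed
  \<comment> \<open>The error constant is that of the rank-preserving step with c = \<sigma> -
    \<rho>, b1 = Cm Cn B and b2 = Cn B.\<close>
  interpret euler_scheme ?f ?M Y0 \<rho> L "Cn * B / (\<sigma> - \<rho>) * (Cm * Cn * B)" T
  proof
    have "?M \<inter> cball Y0 \<rho> = {Y. rank Y \<le> CARD('r)} \<inter> cball Y0 \<rho>" using rk by auto
    then show "closed (?M \<inter> cball Y0 \<rho>)" by (simp add: closed_Int closed_rank_le)
    show "norm (?f y) \<le> L" if "y \<in> ?M \<inter> cball Y0 \<rho>" for y using dec [of y] that by auto
    fix y h assume y: "y \<in> ?M \<inter> cball Y0 \<rho>"
    then have ry: "rank y = CARD('r)" by (simp add: fixed_rank_def)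
    obtain X1 X2 where X: "?f y = X1 + X2" "\<And>j. column j X1 \<in> range ((*v) y)" "norm X1 \<le> Cm * Cn * B"
        "\<And>j. column j (transpose X2) \<in> range ((*v) (transpose y))" "norm X2 \<le> Cn * B"
      using dec [of y] y by auto
    have W: "rank y \<le> dim ?W1" "rank y \<le> dim ?W2"
      using ry rk0 by (simp_all add: dim_range_transpose rank_transpose flip: rank_dim_range)
    have yc: "y \<in> cball Y0 \<rho>" using y by simp
    obtain Y' where Y': "rank Y' \<le> rank y"
        "norm (Y' - y - h *\<^sub>R (X1 + X2)) \<le> (Cn * B / (\<sigma> - \<rho>) * (Cm * Cn * B)) * h\<^sup>2"
      using rank_preserving_step [OF subspace_range_matrix near [OF yc] W(1)
          subspace_range_matrix near' [OF yc] W(2) _ X(2-5)] \<rho> by (metis diff_gt_0_iff_gt)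
    then show "\<exists>y'. norm (y' - y - h *\<^sub>R ?f y) \<le> Cn * B / (\<sigma> - \<rho>) * (Cm * Cn * B) * h\<^sup>2 \<and>
        (y' \<in> cball Y0 \<rho> \<longrightarrow> y' \<in> ?M)"
      using rk ry X(1) by metis
  next
    show "0 \<le> Cn * B / (\<sigma> - \<rho>) * (Cm * Cn * B)" using C \<open>0 < B\<close> \<rho> by simp
  qed (use assms(6) L T \<rho> in auto)
  show ?thesis using filippov_solution_exists T(1) by blast
qed

end
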